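(* Let $\Delta\geq 3$ be an integer. For a given connected $C_4$-free bipartite graph $G$ of maximum degree at most $\Delta$, one can find in polynomial time a uniquely restricted matching $M$ of $G$ of size at least $$\frac{(\Delta-1)^2+(\Delta-2)}{(\Delta-1)^3+(\Delta-2)}\,\nu_{ur}(G).$$
   Context: All graphs are finite, simple, and undirected. A matching in a graph $G$ is a set of pairwise non-adjacent edges of $G$; for a matching $M$, $V(M)$ denotes the set of vertices incident with an edge in $M$. A matching $M$ in $G$ is uniquely restricted if there is no matching $M'$ in $G$ with $M'\neq M$ and $V(M')=V(M)$. The uniquely restricted matching number $\nu_{ur}(G)$ is the maximum size of a uniquely restricted matching in $G$. A graph is $C_4$-free if it contains no cycle of length $4$. "Polynomial time" means time polynomial in the number $n(G)$ of vertices of the input graph $G$. *)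

theory Defs
  imports Complex_Main "HOL-Computational_Algebra.Polynomial"
begin

section \<open>Graphs and uniquely restricted matchings\<close>

definition graph :: "'a set \<Rightarrow> 'a set set \<Rightarrow> bool" where
  "graph V E \<longleftrightarrow> finite V \<and> (\<forall>e\<in>E. e \<subseteq> V \<and> card e = 2)"

definition vertex_degree :: "'a set set \<Rightarrow> 'a \<Rightarrow> nat" where
  "vertex_degree E v = card {e \<in> E. v \<in> e}"

text \<open>Only meaningful for a nonempty vertex set.\<close>

definition max_degree :: "'a set \<Rightarrow> 'a set set \<Rightarrow> nat" where
  "max_degree V E = Max (vertex_degree E ` V)"

definition connected_graph :: "'a set \<Rightarrow> 'a set set \<Rightarrow> bool" where
  "connected_graph V E \<longleftrightarrow> V \<noteq> {} \<and> (\<forall>u\<in>V. \<forall>v\<in>V. (u, v) \<in> {(x, y). {x, y} \<in> E}\<^sup>*)"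

definition bipartite :: "'a set \<Rightarrow> 'a set set \<Rightarrow> bool" where
  "bipartite V E \<longleftrightarrow>
     (\<exists>A B. A \<union> B = V \<and> A \<inter> B = {} \<and> (\<forall>e\<in>E. \<exists>a\<in>A. \<exists>b\<in>B. e = {a, b}))"

definition C4_free :: "'a set set \<Rightarrow> bool" where
  "C4_free E \<longleftrightarrow>
     \<not> (\<exists>a b c d. distinct [a, b, c, d] \<and>
          {a, b} \<in> E \<and> {b, c} \<in> E \<and> {c, d} \<in> E \<and> {d, a} \<in> E)"

definition matching :: "'a set set \<Rightarrow> 'a set set \<Rightarrow> bool" where
  "matching E M \<longleftrightarrow> M \<subseteq> E \<and> (\<forall>e\<in>M. \<forall>f\<in>M. e \<noteq> f \<longrightarrow> e \<inter> f = {})"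

text \<open>The set of vertices covered by \<open>M\<close> is \<open>\<Union>M\<close>.\<close>

definition uniquely_restricted :: "'a set set \<Rightarrow> 'a set set \<Rightarrow> bool" where
  "uniquely_restricted E M \<longleftrightarrow>
     matching E M \<and> \<not> (\<exists>M'. matching E M' \<and> M' \<noteq> M \<and> \<Union>M' = \<Union>M)"

definition ur_matching_number :: "'a set set \<Rightarrow> nat" where
  "ur_matching_number E = Max (card ` {M. uniquely_restricted E M})"

section \<open>Random access machines\<close>

text \<open>
  Running time is measured on a unit-cost random access machine, programmed with structured
  control flow. The memory consists of named banks of cells, each bank indexed by the natural
  numbers, and each cell holds a natural number; \<open>Cell x i\<close> reads the cell of bank \<open>x\<close> whose
  index is the current result of \<open>i\<close> (indirect addressing). A program names only finitely many
  banks. The only arithmetic operations are addition and truncated subtraction, so the bit length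
  of a number grows by at most one per operation. Unit cost is therefore polynomially related to
  logarithmic cost and to Turing machine time; with a unit-cost multiplication this would fail.
\<close>

type_synonym memory = "string \<Rightarrow> nat \<Rightarrow> nat"

datatype aexp =
    Const nat
  | Cell string aexp
  | Add aexp aexp
  | Sub aexp aexp

datatype bexp =
    Less aexp aexp
  | BNot bexp
  | BAnd bexp bexp

datatype com =
    Skip
  | Assign string aexp aexp
  | Seq com com
  | Cond bexp com com
  | While bexp com

primrec aeval :: "aexp \<Rightarrow> memory \<Rightarrow> nat" where
  "aeval (Const k) s = k"
| "aeval (Cell x i) s = s x (aeval i s)"
| "aeval (Add a b) s = aeval a s + aeval b s"
| "aeval (Sub a b) s = aeval a s - aeval b s"

primrec beval :: "bexp \<Rightarrow> memory \<Rightarrow> bool" where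
  "beval (Less a b) s \<longleftrightarrow> aeval a s < aeval b s"
| "beval (BNot b) s \<longleftrightarrow> \<not> beval b s"
| "beval (BAnd b c) s \<longleftrightarrow> beval b s \<and> beval c s"

primrec acost :: "aexp \<Rightarrow> nat" where
  "acost (Const k) = 1"
| "acost (Cell x i) = acost i + 1"
| "acost (Add a b) = acost a + acost b + 1"
| "acost (Sub a b) = acost a + acost b + 1"

primrec bcost :: "bexp \<Rightarrow> nat" where
  "bcost (Less a b) = acost a + acost b + 1"
| "bcost (BNot b) = bcost b + 1"
| "bcost (BAnd b c) = bcost b + bcost c + 1"

text \<open>
  \<open>exec c s t s'\<close>: started in memory \<open>s\<close>, the program \<open>c\<close> halts after exactly \<open>t\<close> steps in
  memory \<open>s'\<close>.
\<close>

inductive exec :: "com \<Rightarrow> memory \<Rightarrow> nat \<Rightarrow> memory \<Rightarrow> bool" where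
  Skip: "exec Skip s 1 s"
| Assign: "exec (Assign x i a) s (acost i + acost a + 1)
             (s(x := (s x)(aeval i s := aeval a s)))"
| Seq: "exec c1 s1 t1 s2 \<Longrightarrow> exec c2 s2 t2 s3 \<Longrightarrow> exec (Seq c1 c2) s1 (t1 + t2) s3"
| CondTrue: "beval b s \<Longrightarrow> exec c1 s t s' \<Longrightarrow> exec (Cond b c1 c2) s (bcost b + t) s'"
| CondFalse: "\<not> beval b s \<Longrightarrow> exec c2 s t s' \<Longrightarrow> exec (Cond b c1 c2) s (bcost b + t) s'"
| WhileFalse: "\<not> beval b s \<Longrightarrow> exec (While b c) s (bcost b) s"
| WhileTrue: "beval b s1 \<Longrightarrow> exec c s1 t1 s2 \<Longrightarrow> exec (While b c) s2 t2 s3 \<Longrightarrow>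
             exec (While b c) s1 (bcost b + t1 + t2) s3"

inductive_cases SkipE: "exec Skip s t s'"
inductive_cases AssignE: "exec (Assign x i a) s t s'"
inductive_cases SeqE: "exec (Seq c1 c2) s t s'"
inductive_cases CondE: "exec (Cond b c1 c2) s t s'"
inductive_cases WhileE: "exec (While b c) s t s'"

lemma exec_deterministic:
  assumes "exec c s t s'" and "exec c s u s''"
  shows "u = t \<and> s'' = s'"
  using assms
proof (induction arbitrary: u s'' rule: exec.induct)
  case (Skip s)
  then show ?case by (rule SkipE) simp
next
  case (Assign x i a s)
  then show ?case by (rule AssignE) simp
next
  case (Seq c1 s1 t1 s2 c2 t2 s3)
  from Seq.prems show ?case by (rule SeqE) (metis Seq.IH)
next
  case (CondTrue b s c1 t s' c2)
  from CondTrue.prems show ?case by (rule CondE) (metis CondTrue.IH CondTrue.hyps)+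
next
  case (CondFalse b s c2 t s' c1)
  from CondFalse.prems show ?case by (rule CondE) (metis CondFalse.IH CondFalse.hyps)+
next
  case (WhileFalse b s c)
  from WhileFalse.prems show ?case by (rule WhileE) (metis WhileFalse.hyps)+
next
  case (WhileTrue b s1 c t1 s2 t2 s3)
  from WhileTrue.prems show ?case by (rule WhileE) (metis WhileTrue.IH WhileTrue.hyps(1))+
qed

section \<open>Graphs as inputs, edge sets as outputs\<close>

text \<open>
  The input graph has vertex set \<open>{..<n}\<close>. Edge sets are stored as 0-1 matrices, row by row.
  In the output, an edge may be marked at either or both of its two positions.
\<close>

definition input_memory :: "nat \<Rightarrow> nat set set \<Rightarrow> memory" where
  "input_memory n E = (\<lambda>x k.
     if x = ''n'' \<and> k = 0 then n
     else if x = ''adj'' \<and> (\<exists>i<n. \<exists>j<n. k = i * n + j \<and> {i, j} \<in> E) then 1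
     else 0)"

definition output_edges :: "nat \<Rightarrow> memory \<Rightarrow> nat set set" where
  "output_edges n s = {{i, j} | i j. i < n \<and> j < n \<and> s ''out'' (i * n + j) \<noteq> 0}"

end

theory Submission
  imports Defs
begin

text \<open>
  Write \<open>d = \<Delta> - 1\<close>; the ratio is \<open>(d\<^sup>2 + d - 1) / (d\<^sup>3 + d - 1)\<close>. The algorithm has two phases.

  \<^emph>\<open>Pruning.\<close> If \<open>v\<close> has \<open>w\<close> as its only neighbour, the edge \<open>{v, w}\<close> can be added to every
  uniquely restricted matching of the graph without \<open>w\<close> (\<open>ur_insert\<close>), and deleting \<open>w\<close> lowers
  \<open>\<nu>\<^sub>u\<^sub>r\<close> by at most one. So pendant edges are taken with ratio one, until every vertex that is
  not isolated has degree at least two.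

  \<^emph>\<open>Growing.\<close> A set \<open>C\<close> is grown within one side of the bipartite graph. A step takes a vertex \<open>v\<close>
  that has a neighbour in \<open>C\<close> and a neighbour \<open>w\<close> outside \<open>C\<close>, puts \<open>{v, w}\<close> into the matching and all
  neighbours of \<open>v\<close> into \<open>C\<close>. As \<open>w\<close> is not adjacent to any vertex matched earlier, the matching
  stays uniquely restricted. A step is called forced if \<open>w\<close> is the only neighbour of \<open>v\<close> outside
  \<open>C\<close>, and branching otherwise; forced steps are taken first. If no step is possible, all of a
  component has been explored, and the process restarts from a single vertex of another one, put
  into \<open>C\<close> unmatched. Either side of the new component will do, so the program does not have to
  find a bipartition.

  In the end \<open>C\<close> is one side of the pruned graph, apart from isolated vertices. A uniquely
  restricted matching cannot cover all vertices of \<open>C\<close> in any component, because the degrees are at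
  least two and there would be an alternating cycle (\<open>ur_not_covers_closed\<close>). Hence the pruned graph
  has \<open>\<nu>\<^sub>u\<^sub>r \<le> |C| - s\<close> if there were \<open>s\<close> restarts, and it remains to compare \<open>|C| - s\<close> with the number \<open>k\<close> of steps.

  A step puts at most \<open>d\<close> new vertices into \<open>C\<close>, which alone would give the ratio \<open>1 / d\<close>. The gain
  comes from forced steps, and these must be frequent. Call a vertex saturated if its neighbours
  are all in \<open>C\<close>, and a vertex of \<open>C\<close> poor if it has at most one saturated neighbour. When the
  process ends, nothing is poor. A branching step saturates \<open>v\<close> alone, since another vertex would
  have had two common neighbours with \<open>v\<close> or would have allowed a forced step; so a branching step
  with \<open>d\<close> new vertices creates at least \<open>d - 1\<close> more poor vertices than it removes. A forced step
  can remove only about \<open>d\<^sup>2\<close> of them. So about \<open>d\<^sup>2\<close> branching steps require \<open>d - 1\<close> forced ones, and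
  \<open>d\<^sup>2 + (d - 1)\<close> steps account for at most \<open>d\<^sup>2 \<cdot> d + (d - 1)\<close> vertices. The predicate
  \<open>potential\<close> makes this exact, and the lemmas \<open>potential_forced_step\<close>,
  \<open>potential_branching_step\<close> and \<open>potential_restart\<close> say that it is maintained.
\<close>

section \<open>Uniquely restricted matchings\<close>

definition nbrs :: "'a set set \<Rightarrow> 'a \<Rightarrow> 'a set" where
  "nbrs E v = {w. {v, w} \<in> E}"

lemma nbrs_sym: "w \<in> nbrs E v \<longleftrightarrow> v \<in> nbrs E w"
  by (simp add: nbrs_def insert_commute)

lemma not_nbrs_self: "graph V E \<Longrightarrow> v \<notin> nbrs E v"
  by (auto simp: nbrs_def graph_def)

lemma nbrs_subset: "graph V E \<Longrightarrow> nbrs E v \<subseteq> V"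
  by (auto simp: nbrs_def graph_def)

lemma finite_nbrs: "graph V E \<Longrightarrow> finite (nbrs E v)"
  using nbrs_subset finite_subset by (metis graph_def)

lemma graph_subset: "graph V E \<Longrightarrow> L \<subseteq> E \<Longrightarrow> graph V L"
  by (auto simp: graph_def)

lemma finite_edges:
  assumes "graph V E"
  shows "finite E"
proof -
  have "E \<subseteq> Pow V" "finite (Pow V)"
    using assms by (auto simp: graph_def)
  then show ?thesis by (rule finite_subset)
qed

lemma edge_pair:
  assumes "graph V E" "e \<in> E" "v \<in> e"
  obtains w where "e = {v, w}" "w \<noteq> v"
proof -
  have "card e = 2" using assms by (auto simp: graph_def)
  then obtain x y where "e = {x, y}" "x \<noteq> y" by (auto simp: card_2_iff)
  then show thesis using that[of x] that[of y] assms(3) by auto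
qed

lemma vertex_degree_nbrs:
  assumes "graph V E"
  shows "vertex_degree E v = card (nbrs E v)"
proof -
  have "bij_betw (\<lambda>w. {v, w}) (nbrs E v) {e \<in> E. v \<in> e}"
    unfolding bij_betw_def
  proof
    show "inj_on (\<lambda>w. {v, w}) (nbrs E v)"
      using not_nbrs_self[OF assms] by (auto simp: inj_on_def doubleton_eq_iff)
    show "(\<lambda>w. {v, w}) ` nbrs E v = {e \<in> E. v \<in> e}"
    proof (intro equalityI subsetI)
      fix e assume "e \<in> {e \<in> E. v \<in> e}"
      then have e: "e \<in> E" "v \<in> e" by auto
      then obtain w where "e = {v, w}" by (rule edge_pair[OF assms])
      then show "e \<in> (\<lambda>w. {v, w}) ` nbrs E v" using e by (auto simp: nbrs_def)
    qed (auto simp: nbrs_def)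
  qed
  then show ?thesis by (simp add: vertex_degree_def bij_betw_same_card)
qed

lemma degree_le_max_degree:
  assumes "graph V E" "max_degree V E \<le> k"
  shows "card (nbrs E v) \<le> k"
proof (cases "v \<in> V")
  case True
  then have "vertex_degree E v \<le> max_degree V E"
    using assms(1) by (auto simp: max_degree_def graph_def)
  then show ?thesis using assms vertex_degree_nbrs[OF assms(1)] by simp
next
  case False
  then have "nbrs E v = {}"
    using assms(1) by (auto simp: nbrs_def graph_def)
  then show ?thesis by simp
qed

lemma matching_subset: "matching E M \<Longrightarrow> N \<subseteq> M \<Longrightarrow> N \<subseteq> L \<Longrightarrow> matching L N"
  unfolding matching_def by blast

lemma matching_Un:
  assumes "matching E M" "matching E N" "\<And>e f. e \<in> M \<Longrightarrow> f \<in> N \<Longrightarrow> e \<inter> f = {}"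
  shows "matching E (M \<union> N)"
  unfolding matching_def
proof (intro conjI ballI impI)
  show "M \<union> N \<subseteq> E" using assms(1,2) by (simp add: matching_def)
  fix e f assume "e \<in> M \<union> N" "f \<in> M \<union> N" "e \<noteq> f"
  then consider "e \<in> M" "f \<in> M" | "e \<in> M" "f \<in> N" | "e \<in> N" "f \<in> M" | "e \<in> N" "f \<in> N"
    by blast
  then show "e \<inter> f = {}"
  proof cases
    case 1 then show ?thesis using assms(1) \<open>e \<noteq> f\<close> by (simp add: matching_def)
  next
    case 2 then show ?thesis by (rule assms(3))
  next
    case 3 then show ?thesis using assms(3)[of f e] by (simp add: Int_commute)
  next
    case 4 then show ?thesis using assms(2) \<open>e \<noteq> f\<close> by (simp add: matching_def)
  qed
qed

lemma matchingD: "matching E M \<Longrightarrow> e \<in> M \<Longrightarrow> f \<in> M \<Longrightarrow> v \<in> e \<Longrightarrow> v \<in> f \<Longrightarrow> e = f"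
  by (auto simp: matching_def)

lemma ur_matching: "uniquely_restricted E M \<Longrightarrow> matching E M"
  by (simp add: uniquely_restricted_def)

lemma ur_unique: "uniquely_restricted E M \<Longrightarrow> matching E N \<Longrightarrow> \<Union>N = \<Union>M \<Longrightarrow> N = M"
  by (auto simp: uniquely_restricted_def)

lemma ur_empty:
  assumes "graph V E"
  shows "uniquely_restricted E {}"
proof -
  have "{} \<notin> E" using assms by (auto simp: graph_def)
  then have "M = {}" if "matching E M" "\<Union>M = \<Union>{}" for M
    using that unfolding matching_def by (metis Union_empty_conv all_not_in_conv subsetD)
  moreover have "matching E {}" by (simp add: matching_def)
  ultimately show ?thesis unfolding uniquely_restricted_def by blast
qed

text \<open>A second matching on the vertices of a part of \<open>M\<close> could be completed by the rest of
  \<open>M\<close>.\<close>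

lemma ur_subset:
  assumes "graph V E" "uniquely_restricted E M" "N \<subseteq> M" "N \<subseteq> L" "L \<subseteq> E"
  shows "uniquely_restricted L N"
  unfolding uniquely_restricted_def
proof (intro conjI notI)
  have M: "matching E M" using assms(2) by (rule ur_matching)
  show "matching L N" using M assms by (blast intro: matching_subset)
  have ne: "e \<noteq> {}" if "e \<in> E" for e using that assms(1) by (auto simp: graph_def)
  assume "\<exists>N'. matching L N' \<and> N' \<noteq> N \<and> \<Union>N' = \<Union>N"
  then obtain N' where N': "matching L N'" "N' \<noteq> N" "\<Union>N' = \<Union>N" by blast
  have disj: "e \<inter> f = {}" if "e \<in> N'" "f \<in> M - N" for e f
  proof (rule ccontr)
    assume "e \<inter> f \<noteq> {}"
    then obtain v where "v \<in> e" "v \<in> f" by blast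
    then have "v \<in> \<Union>N" unfolding N'(3)[symmetric] using \<open>e \<in> N'\<close> by blast
    then obtain g where "g \<in> N" "v \<in> g" by blast
    then show False using matchingD[OF M, of g f v] that \<open>v \<in> f\<close> assms(3) by blast
  qed
  have MN: "matching E (M - N)" using M by (intro matching_subset[OF M]) (auto simp: matching_def)
  have NE: "matching E N'" using N'(1) assms(5) by (auto simp: matching_def)
  have sub: "N' \<subseteq> E" using NE by (simp add: matching_def)
  have "matching E (N' \<union> (M - N))" using disj by (intro matching_Un NE MN)
  moreover have "\<Union>(N' \<union> (M - N)) = \<Union>M"
    unfolding Union_Un_distrib N'(3) using assms(3) by blast
  ultimately have eq: "N' \<union> (M - N) = M" using ur_unique[OF assms(2)] by blast
  have "N' \<subseteq> N"
  proof
    fix e assume "e \<in> N'"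
    then show "e \<in> N" using disj[of e e] ne[of e] eq sub by blast
  qed
  moreover have "N \<subseteq> N'" using eq assms(3) by blast
  ultimately show False using N'(2) by blast
qed

text \<open>The vertex \<open>v\<close> can only be matched to \<open>u\<close>, whatever the matching, so the choice at \<open>v\<close> is
  forced and uniqueness is left to \<open>M\<close>. The edge set \<open>L\<close> may be all of \<open>E\<close>, when a matching is
  extended, or \<open>E\<close> without the edges at \<open>u\<close>, when \<open>u\<close> is deleted first.\<close>

lemma ur_insert:
  assumes "graph V E" "uniquely_restricted L M" "L \<subseteq> E" "{e \<in> E. u \<notin> e} \<subseteq> L"
    and "{u, v} \<in> E" "u \<notin> \<Union>M" "v \<notin> \<Union>M" "nbrs E v \<inter> \<Union>M = {}"
  shows "uniquely_restricted E (insert {u, v} M)" "card (insert {u, v} M) = card M + 1"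
proof -
  have M: "matching L M" using assms(2) by (rule ur_matching)
  then have "finite M"
    using finite_edges[OF assms(1)] assms(3) by (meson finite_subset matching_def)
  then show "card (insert {u, v} M) = card M + 1"
    using assms(6) by (subst card_insert_disjoint) auto
  have unique: "N = insert {u, v} M" if N: "matching E N" "\<Union>N = \<Union>(insert {u, v} M)" for N
  proof -
    obtain e where e: "e \<in> N" "v \<in> e" using N(2) by blast
    have NE: "N \<subseteq> E" using N(1) by (simp add: matching_def)
    obtain z where z: "e = {v, z}" "z \<noteq> v" using edge_pair[OF assms(1)] e NE by blast
    have "z \<in> nbrs E v" "z \<in> \<Union>N" using z e NE by (auto simp: nbrs_def)
    then have "z = u" using N(2) assms(8) z(2) by auto
    then have uv: "{u, v} \<in> N" using e(1) z(1) by (simp add: insert_commute)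
    have rest: "u \<notin> f" "v \<notin> f" if "f \<in> N - {{u, v}}" for f
      using matchingD[OF N(1) uv, of f] that by auto
    have "matching L (N - {{u, v}})"
      using rest(1) NE assms(4) by (intro matching_subset[OF N(1)]) auto
    moreover have "\<Union>(N - {{u, v}}) = \<Union>M"
    proof
      show "\<Union>(N - {{u, v}}) \<subseteq> \<Union>M"
      proof
        fix x assume "x \<in> \<Union>(N - {{u, v}})"
        then obtain f where f: "f \<in> N - {{u, v}}" "x \<in> f" by (rule UnionE)
        then have "x \<noteq> u" "x \<noteq> v" using rest by metis+
        moreover have "x \<in> \<Union>(insert {u, v} M)" using f N(2) by blast
        ultimately show "x \<in> \<Union>M" by auto
      qed
      show "\<Union>M \<subseteq> \<Union>(N - {{u, v}})"
      proof
        fix x assume x: "x \<in> \<Union>M"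
        then have "x \<noteq> u" "x \<noteq> v" using assms(6,7) by auto
        moreover have "x \<in> \<Union>N" using x N(2) by auto
        ultimately show "x \<in> \<Union>(N - {{u, v}})" by auto
      qed
    qed
    ultimately have "N - {{u, v}} = M" using ur_unique[OF assms(2)] by blast
    then show ?thesis using uv by blast
  qed
  have "matching E (insert {u, v} M)"
    using M assms(3,5,6,7) unfolding matching_def by blast
  then show "uniquely_restricted E (insert {u, v} M)"
    unfolding uniquely_restricted_def using unique by blast
qed

lemma finite_ur_matchings:
  assumes "graph V E"
  shows "finite {M. uniquely_restricted E M}"
proof (rule finite_subset)
  show "{M. uniquely_restricted E M} \<subseteq> Pow E"
    by (auto simp: uniquely_restricted_def matching_def)
  show "finite (Pow E)" using finite_edges[OF assms] by simp
qed

lemma ur_number_attained: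
  assumes "graph V E"
  obtains M where "uniquely_restricted E M" "card M = ur_matching_number E"
proof -
  have "ur_matching_number E \<in> card ` {M. uniquely_restricted E M}"
    unfolding ur_matching_number_def
    using finite_ur_matchings[OF assms] ur_empty[OF assms] by (intro Max_in) auto
  then show thesis using that by auto
qed

lemma card_le_ur_number:
  assumes "graph V E" "uniquely_restricted E M"
  shows "card M \<le> ur_matching_number E"
  unfolding ur_matching_number_def
  using finite_ur_matchings[OF assms(1)] assms(2) by (intro Max_ge) auto

lemma ur_number_delete_vertex:
  assumes "graph V E"
  shows "ur_matching_number E \<le> ur_matching_number {e \<in> E. u \<notin> e} + 1"
proof -
  obtain X where X: "uniquely_restricted E X" "card X = ur_matching_number E"
    using ur_number_attained[OF assms] by blast
  have m: "matching E X" using X(1) by (rule ur_matching)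
  then have XE: "X \<subseteq> E" by (simp add: matching_def)
  have "uniquely_restricted {e \<in> E. u \<notin> e} {e \<in> X. u \<notin> e}"
    using XE by (intro ur_subset[OF assms X(1)]) auto
  moreover have "graph V {e \<in> E. u \<notin> e}" using assms by (rule graph_subset) auto
  ultimately have "card {e \<in> X. u \<notin> e} \<le> ur_matching_number {e \<in> E. u \<notin> e}"
    by (intro card_le_ur_number)
  moreover have "card {e \<in> X. u \<in> e} \<le> Suc 0"
  proof -
    have "finite X" using XE finite_edges[OF assms] by (rule finite_subset)
    moreover have "e = f" if "e \<in> X" "f \<in> X" "u \<in> e" "u \<in> f" for e f
      using matchingD[OF m that(1,2)] that(3,4) .
    ultimately show ?thesis by (subst card_le_Suc0_iff_eq) auto
  qed
  moreover have "card X \<le> card {e \<in> X. u \<notin> e} + card {e \<in> X. u \<in> e}"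
  proof -
    have "X = {e \<in> X. u \<notin> e} \<union> {e \<in> X. u \<in> e}" by blast
    then show ?thesis using card_Un_le[of "{e \<in> X. u \<notin> e}" "{e \<in> X. u \<in> e}"] by simp
  qed
  ultimately show ?thesis using X(2) by linarith
qed

text \<open>A nonempty subset of least size among those mapped into themselves is permuted.\<close>

lemma finite_self_map_permutes_subset:
  assumes "finite K" "K \<noteq> {}" "f ` K \<subseteq> K"
  shows "\<exists>Z\<subseteq>K. Z \<noteq> {} \<and> f ` Z = Z \<and> inj_on f Z"
proof -
  let ?P = "\<lambda>Z. Z \<subseteq> K \<and> Z \<noteq> {} \<and> f ` Z \<subseteq> Z"
  have "?P K" using assms by blast
  then obtain Z where Z: "?P Z" and least: "\<And>Y. ?P Y \<Longrightarrow> card Z \<le> card Y"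
    using ex_has_least_nat[of ?P K card] by blast
  have fin: "finite Z" using Z assms(1) finite_subset by blast
  have "?P (f ` Z)" using Z by blast
  then have "card Z \<le> card (f ` Z)" using least by blast
  then have "f ` Z = Z" using Z fin by (meson card_seteq)
  then show ?thesis using Z fin by (metis eq_card_imp_inj_on)
qed

text \<open>Starting from a vertex of \<open>K\<close>, going to its partner and from there to another vertex of
  \<open>K\<close> never gets stuck. This runs into an alternating cycle, along which the matching can be
  exchanged.\<close>

lemma ur_not_covers_closed:
  assumes G: "graph V E" and "uniquely_restricted E M"
    and K: "finite K" "K \<noteq> {}" "\<And>b. b \<in> K \<Longrightarrow> nbrs E b \<inter> K = {}"
    and closed: "\<And>b a. b \<in> K \<Longrightarrow> a \<in> nbrs E b \<Longrightarrow> nbrs E a \<subseteq> K"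
    and deg: "\<And>b a. b \<in> K \<Longrightarrow> a \<in> nbrs E b \<Longrightarrow> 2 \<le> card (nbrs E a)"
  shows "\<not> K \<subseteq> \<Union>M"
proof
  assume cover: "K \<subseteq> \<Union>M"
  have M: "matching E M" using assms(2) by (rule ur_matching)
  then have ME: "M \<subseteq> E" by (simp add: matching_def)
  have "\<exists>a. {b, a} \<in> M" if b: "b \<in> K" for b
    using b cover ME edge_pair[OF G] by (metis Union_iff subset_iff)
  then obtain g where g: "\<And>b. b \<in> K \<Longrightarrow> {b, g b} \<in> M" by metis
  have gn: "g b \<in> nbrs E b" if "b \<in> K" for b
    using g[OF that] ME by (auto simp: nbrs_def)
  have "\<exists>c. c \<in> nbrs E (g b) \<and> c \<noteq> b" if b: "b \<in> K" for b
  proof (rule ccontr)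
    assume "\<nexists>c. c \<in> nbrs E (g b) \<and> c \<noteq> b"
    then have "nbrs E (g b) \<subseteq> {b}" by blast
    then have "card (nbrs E (g b)) \<le> card {b}" by (intro card_mono) auto
    then show False using deg[OF b gn[OF b]] by simp
  qed
  then obtain f where f: "\<And>b. b \<in> K \<Longrightarrow> f b \<in> nbrs E (g b)" "\<And>b. b \<in> K \<Longrightarrow> f b \<noteq> b" by metis
  have fK: "f b \<in> K" if "b \<in> K" for b using f(1) closed gn that by blast
  have gK: "g b \<notin> K" if "b \<in> K" for b using gn K(3) that by blast
  obtain Z where Z: "Z \<subseteq> K" "Z \<noteq> {}" "f ` Z = Z" "inj_on f Z"
    using finite_self_map_permutes_subset[OF K(1,2), of f] fK by blast
  have g_inj: "b = c" if "b \<in> K" "c \<in> K" "g b = g c" for b c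
    using matchingD[OF M g g, of b c "g b"] that gK by (auto simp: doubleton_eq_iff)
  \<comment> \<open>Along the cycles of \<open>f\<close> on \<open>Z\<close>, the edges in \<open>R\<close> are exchanged for those in \<open>A\<close>.\<close>
  define R A where R_def: "R = (\<lambda>b. {b, g b}) ` Z" and A_def: "A = (\<lambda>b. {f b, g b}) ` Z"
  have R: "R \<subseteq> M" unfolding R_def using g Z(1) by blast
  have A: "A \<subseteq> E" using f(1) Z(1) by (auto simp: A_def nbrs_def insert_commute)
  have "\<Union>A = f ` Z \<union> g ` Z" "\<Union>R = Z \<union> g ` Z" by (auto simp: R_def A_def)
  then have UA: "\<Union>A = \<Union>R" using Z(3) by simp
  have old_new: "e \<inter> h = {}" if "e \<in> M - R" "h \<in> A" for e h
  proof (rule ccontr)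
    assume "e \<inter> h \<noteq> {}"
    then obtain x where x: "x \<in> e" "x \<in> h" by blast
    have "x \<in> \<Union>A" by (rule UnionI[OF that(2) x(2)])
    then have "x \<in> \<Union>R" by (simp only: UA)
    then obtain r where r: "r \<in> R" "x \<in> r" by (rule UnionE)
    have "e \<in> M" "e \<notin> R" "r \<in> M" using that(1) r(1) R by blast+
    then show False using matchingD[OF M, of e r x] x(1) r by metis
  qed
  have new_new: "e = h" if "e \<in> A" "h \<in> A" "e \<inter> h \<noteq> {}" for e h
  proof -
    obtain b c where bc: "b \<in> Z" "c \<in> Z" "e = {f b, g b}" "h = {f c, g c}" 
      using \<open>e \<in> A\<close> \<open>h \<in> A\<close> unfolding A_def by blast
    then have "f b \<noteq> g c" "f c \<noteq> g b" using fK gK Z(1) by (metis subset_iff)+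
    then have "f b = f c \<or> g b = g c" using that(3) bc by auto
    moreover have "b \<in> K" "c \<in> K" using bc(1,2) Z(1) by auto
    ultimately have "b = c" using inj_onD[OF Z(4) _ bc(1,2)] g_inj by blast
    then show ?thesis using bc by simp
  qed
  have "matching E (M - R)" by (intro matching_subset[OF M]) (use ME in auto)
  moreover have "matching E A"
    unfolding matching_def using A new_new by blast
  ultimately have "matching E ((M - R) \<union> A)" using old_new by (intro matching_Un)
  moreover have "\<Union>((M - R) \<union> A) = \<Union>M"
  proof -
    have "\<Union>((M - R) \<union> A) = \<Union>(M - R) \<union> \<Union>R" using UA by (simp only: Union_Un_distrib)
    also have "\<dots> = \<Union>M" using R by blast
    finally show ?thesis .
  qed
  ultimately have eq: "(M - R) \<union> A = M" using ur_unique[OF assms(2)] by blast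
  obtain b where b: "b \<in> Z" using Z(2) by blast
  then have "{f b, g b} \<in> M" using eq by (auto simp: A_def)
  then have "{f b, g b} = {b, g b}" using matchingD[OF M _ g, of "{f b, g b}" b "g b"] b Z(1) by blast
  then show False using f(2)[of b] b Z(1) by (auto simp: doubleton_eq_iff)
qed

section \<open>Growing one side of a pruned graph\<close>

locale pruned_graph =
  fixes V :: "'a set" and L :: "'a set set" and d :: nat
  assumes graph: "graph V L"
    and C4: "C4_free L"
    and deg_le: "card (nbrs L v) \<le> d + 1"
    and deg_ge: "nbrs L v \<noteq> {} \<Longrightarrow> 2 \<le> card (nbrs L v)"
    and d: "2 \<le> d"
begin

abbreviation N where "N \<equiv> nbrs L"

definition saturated :: "'a set \<Rightarrow> 'a set" where
  "saturated C = {a. N a \<noteq> {} \<and> N a \<subseteq> C}"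

definition poor :: "'a set \<Rightarrow> 'a set" where
  "poor C = {b \<in> C. card (N b \<inter> saturated C) \<le> 1}"

text \<open>No step from \<open>C\<close> is forced; moreover no vertex, near \<open>C\<close> or not, has exactly one neighbour
  outside.\<close>

definition settled :: "'a set \<Rightarrow> bool" where
  "settled C \<longleftrightarrow> (\<forall>a. \<not> N a \<subseteq> C \<longrightarrow> 2 \<le> card (N a - C))"

text \<open>The claim \<open>(d\<^sup>2 + d - 1) (|C| - s) \<le> (d\<^sup>3 + d - 1) k\<close>, with a credit of \<open>d - 1\<close> for each vertex
  in \<open>P\<close>. A forced step changes the inequality by \<open>d\<^sup>2 (d - 1)\<close> in favour of the matching and so pays
  for the loss of \<open>d\<^sup>2\<close> vertices of \<open>P\<close>; a branching step with \<open>d\<close> new vertices changes it by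
  \<open>(d - 1)\<^sup>2\<close> against, which \<open>d - 1\<close> additional vertices in \<open>P\<close> compensate.\<close>

definition balance :: "'a set \<Rightarrow> nat \<Rightarrow> nat \<Rightarrow> 'a set \<Rightarrow> bool" where
  "balance C k s P \<longleftrightarrow> (int d ^ 2 + int d - 1) * (int (card C) - int s)
     \<le> (int d ^ 3 + int d - 1) * int k + (int d - 1) * int (card P)"

text \<open>The credit available depends on the moment. Let \<open>C0\<close> be the set \<open>C\<close> before the last branching
  step (or restart). Between this step and the first forced step that follows, all poor vertices
  count. From then on only the poor vertices in \<open>C0\<close> do, and later forced steps are cheap: a vertex
  that they saturate has at least two neighbours outside \<open>C0\<close>, as \<open>C0\<close> is settled, and hence at most
  \<open>d - 1\<close> neighbours in \<open>C0\<close>.\<close>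

definition potential :: "'a set \<Rightarrow> nat \<Rightarrow> nat \<Rightarrow> bool" where
  "potential C k s \<longleftrightarrow> finite C \<and> (\<exists>C0\<subseteq>C. settled C0 \<and>
     (balance C k s (poor C \<inter> C0) \<or> card (C - C0) \<le> d \<and> balance C k s (poor C)))"

lemma finite_N: "finite (N v)"
  by (rule finite_nbrs[OF graph])

lemma N_sym: "w \<in> N v \<longleftrightarrow> v \<in> N w"
  by (rule nbrs_sym)

lemma common_nbrs_unique:
  assumes "a \<noteq> a'" "x \<in> N a" "x \<in> N a'" "y \<in> N a" "y \<in> N a'"
  shows "x = y"
proof (rule ccontr)
  assume "x \<noteq> y"
  moreover have "a \<noteq> x" "a \<noteq> y" "a' \<noteq> x" "a' \<noteq> y"
    using assms not_nbrs_self[OF graph] by blast+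
  moreover have "{a, x} \<in> L" "{x, a'} \<in> L" "{a', y} \<in> L" "{y, a} \<in> L"
    using assms by (auto simp: nbrs_def insert_commute)
  ultimately show False using C4 assms(1) unfolding C4_free_def
    by (metis distinct_length_2_or_more distinct_singleton)
qed

lemma finite_poor: "finite C \<Longrightarrow> finite (poor C)"
  by (simp add: poor_def)

lemma poor_subset: "poor C \<subseteq> C"
  by (auto simp: poor_def)

lemma saturated_mono: "C \<subseteq> D \<Longrightarrow> saturated C \<subseteq> saturated D"
  by (auto simp: saturated_def)

lemma poor_lost:
  assumes "C \<subseteq> D"
  shows "poor C - poor D \<subseteq> (\<Union>a \<in> saturated D - saturated C. N a)"
proof
  fix b assume b: "b \<in> poor C - poor D"
  then have "N b \<inter> saturated D \<noteq> N b \<inter> saturated C"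
    using assms by (auto simp: poor_def)
  then obtain a where "a \<in> N b" "a \<in> saturated D - saturated C"
    using saturated_mono[OF assms] by blast
  then show "b \<in> (\<Union>a \<in> saturated D - saturated C. N a)" using N_sym by blast
qed

lemma potential_weaken:
  assumes "potential C k s"
  shows "balance C k s (poor C)"
proof -
  obtain C0 where "balance C k s (poor C \<inter> C0) \<or> balance C k s (poor C)" and "finite C"
    using assms by (auto simp: potential_def)
  moreover have "int (card (poor C \<inter> C0)) \<le> int (card (poor C))" if "finite C" for C0
    using that finite_poor by (simp add: card_mono)
  then have "(int d - 1) * int (card (poor C \<inter> C0)) \<le> (int d - 1) * int (card (poor C))"
    if "finite C" for C0
    using that d by (intro mult_left_mono) auto
  ultimately show ?thesis unfolding balance_def by (metis add_left_mono order_trans)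
qed

lemma potential_empty: "potential {} 0 0"
proof -
  have "settled {}" using deg_ge by (auto simp: settled_def)
  then show ?thesis by (auto simp: potential_def balance_def)
qed

text \<open>The room that a forced step leaves: it adds one vertex and one edge, and
  \<open>(d\<^sup>3 + d - 1) - (d\<^sup>2 + d - 1) = d\<^sup>2 (d - 1)\<close>.\<close>

lemma balance_gain:
  assumes "balance C k s P" "finite C" "w \<notin> C" "card P \<le> card P' + d ^ 2"
  shows "balance (insert w C) (k + 1) s P'"
proof -
  have "int (card P) \<le> int (card P') + int d ^ 2"
    using assms(4) by (simp flip: of_nat_power of_nat_add)
  then have "(int d - 1) * int (card P) \<le> (int d - 1) * (int (card P') + int d ^ 2)"
    using d by (intro mult_left_mono) auto
  then show ?thesis using assms(1-3) unfolding balance_def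
    by (simp add: algebra_simps power2_eq_square power3_eq_cube)
qed

text \<open>Every newly saturated vertex is a neighbour of \<open>w\<close> and has at most \<open>d - 1\<close> neighbours in \<open>C0\<close>.
  There are at most \<open>d + 1\<close> of them, so at most \<open>(d + 1) (d - 1) < d\<^sup>2\<close> poor vertices of \<open>C0\<close> are lost.
  At the first forced step after a branching one, the credit of the up to \<open>d\<close> vertices in \<open>C - C0\<close> is
  given up as well. But then the newly saturated vertices need different neighbours in \<open>C - C0\<close>,
  so there are at most \<open>|C - C0|\<close> of them, and at most \<open>|C - C0| (d - 1) + |C - C0| \<le> d\<^sup>2\<close> vertices
  cease to count.\<close>

lemma potential_forced_step:
  assumes pot: "potential C k s" and v: "N v - C = {w}"
  shows "potential (insert w C) (k + 1) s"
proof -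
  obtain C0 where C0: "C0 \<subseteq> C" "settled C0" and fin: "finite C"
    and bal: "balance C k s (poor C \<inter> C0) \<or> card (C - C0) \<le> d \<and> balance C k s (poor C)"
    using pot by (auto simp: potential_def)
  let ?C' = "insert w C"
  define T where "T = saturated ?C' - saturated C"
  have w: "w \<notin> C" "w \<notin> C0" using v C0 by auto
  have wT: "w \<in> N a" "N a \<subseteq> ?C'" if "a \<in> T" for a
    using that by (auto simp: T_def saturated_def)
  then have TN: "T \<subseteq> N w" using N_sym by blast
  then have finT: "finite T" using finite_N finite_subset by blast
  have cardT: "card T \<le> d + 1"
    using card_mono[OF finite_N TN] deg_le[of w] by linarith
  have two: "2 \<le> card (N a - C0)" if "a \<in> T" for a
    using wT[OF that] w C0(2) by (auto simp: settled_def)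
  have few: "card (N a \<inter> C0) \<le> d - 1" if "a \<in> T" for a
  proof -
    have "card (N a) = card (N a \<inter> C0) + card (N a - C0)"
      using finite_N by (metis card_Int_Diff)
    then show ?thesis using two[OF that] deg_le[of a] by linarith
  qed
  let ?P' = "poor ?C' \<inter> C0"
  have "poor C \<inter> C0 - ?P' \<subseteq> (\<Union>a\<in>T. N a \<inter> C0)"
    using poor_lost[of C ?C'] unfolding T_def by blast
  then have "card (poor C \<inter> C0 - ?P') \<le> card (\<Union>a\<in>T. N a \<inter> C0)"
    using finT finite_N by (intro card_mono) auto
  also have "\<dots> \<le> (\<Sum>a\<in>T. card (N a \<inter> C0))" using finT by (rule card_UN_le)
  also have "\<dots> \<le> of_nat (card T) * (d - 1)" using few by (rule sum_bounded_above)
  finally have lost: "card (poor C \<inter> C0 - ?P') \<le> card T * (d - 1)" by simp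
  have finP: "finite (poor C \<inter> C0)" using fin finite_poor by blast
  have "card (poor C \<inter> C0) \<le> card (?P' \<union> (poor C \<inter> C0 - ?P'))"
    using fin finP finite_poor by (intro card_mono) auto
  also have "\<dots> \<le> card ?P' + card (poor C \<inter> C0 - ?P')" by (rule card_Un_le)
  finally have "card (poor C \<inter> C0) \<le> card ?P' + card (poor C \<inter> C0 - ?P')" .
  with lost have keep: "card (poor C \<inter> C0) \<le> card ?P' + card T * (d - 1)" by linarith
  have "balance ?C' (k + 1) s ?P'"
    using bal
  proof
    assume "balance C k s (poor C \<inter> C0)"
    moreover have "card T * (d - 1) \<le> d ^ 2"
    proof -
      have "card T * (d - 1) \<le> (d + 1) * (d - 1)" using cardT by (rule mult_le_mono1)
      also have "\<dots> \<le> d ^ 2" using d by (simp add: algebra_simps power2_eq_square)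
      finally show ?thesis .
    qed
    ultimately show ?thesis using keep balance_gain fin w(1) by (meson add_left_mono le_trans)
  next
    assume B: "card (C - C0) \<le> d \<and> balance C k s (poor C)"
    \<comment> \<open>Distinct vertices of \<open>T\<close> have distinct neighbours in \<open>C - C0\<close>, as they share \<open>w\<close>.\<close>
    have "\<exists>x. x \<in> N a \<and> x \<in> C - C0" if "a \<in> T" for a
    proof (rule ccontr)
      assume "\<nexists>x. x \<in> N a \<and> x \<in> C - C0"
      then have "N a - C0 \<subseteq> {w}" using wT[OF that] by blast
      then have "card (N a - C0) \<le> card {w}" by (intro card_mono) auto
      then show False using two[OF that] by simp
    qed
    then obtain x where x: "\<And>a. a \<in> T \<Longrightarrow> x a \<in> N a \<and> x a \<in> C - C0" by metis
    have "inj_on x T"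
    proof (rule inj_onI)
      fix a a' assume a: "a \<in> T" "a' \<in> T" "x a = x a'"
      show "a = a'"
      proof (rule ccontr)
        assume "a \<noteq> a'"
        then have "x a = w" using common_nbrs_unique[of a a' "x a" w] x a wT by metis
        then show False using x[OF a(1)] w by blast
      qed
    qed
    then have T: "card T \<le> card (C - C0)"
      using x fin by (intro card_inj_on_le[of x]) auto
    have "poor C \<subseteq> (poor C \<inter> C0) \<union> (C - C0)" using poor_subset by blast
    then have "card (poor C) \<le> card ((poor C \<inter> C0) \<union> (C - C0))"
      using finP fin by (intro card_mono) auto
    also have "\<dots> \<le> card (poor C \<inter> C0) + card (C - C0)" by (rule card_Un_le)
    also have "\<dots> \<le> card ?P' + (card T * (d - 1) + card (C - C0))" using keep by linarith
    also have "card T * (d - 1) + card (C - C0) \<le> card (C - C0) * (d - 1) + card (C - C0)"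
      using T by simp
    also have "\<dots> = card (C - C0) * d" using d by (simp add: algebra_simps flip: mult_Suc_right)
    also have "\<dots> \<le> d * d" using B by simp
    finally have "card (poor C) \<le> card ?P' + d ^ 2" by (simp add: power2_eq_square)
    then show ?thesis using B balance_gain[OF _ fin w(1)] by blast
  qed
  then show ?thesis using C0 fin by (auto simp: potential_def)
qed

text \<open>Only \<open>v\<close> becomes saturated: any other vertex shares at most one neighbour with \<open>v\<close>, and since \<open>C\<close>
  is settled it has no or at least two neighbours outside \<open>C\<close>. So the \<open>x\<close> new vertices are poor, and at most
  \<open>d + 1 - x\<close> old ones stop being poor. With these numbers the inequality changes by
  \<open>(d - x) (d\<^sup>2 - d + 1)\<close> in favour of the matching, and \<open>x \<le> d\<close> because \<open>v\<close> has a neighbour in \<open>C\<close>.\<close>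

lemma potential_branching_step:
  assumes pot: "potential C k s" and set: "settled C"
    and v: "N v \<inter> C \<noteq> {}" "\<not> N v \<subseteq> C"
  shows "potential (C \<union> N v) (k + 1) s"
proof -
  have fin: "finite C" using pot by (simp add: potential_def)
  let ?C' = "C \<union> N v"
  have old_new: "card (N v) = card (N v \<inter> C) + card (N v - C)"
    using finite_N by (metis card_Int_Diff)
  have old: "0 < card (N v \<inter> C)" using v finite_N by (simp add: card_gt_0_iff)
  have only: "saturated ?C' - saturated C \<subseteq> {v}"
  proof
    fix a assume a: "a \<in> saturated ?C' - saturated C"
    then have Na: "N a \<subseteq> ?C'" "\<not> N a \<subseteq> C" by (auto simp: saturated_def)
    show "a \<in> {v}"
    proof (rule ccontr)
      assume "a \<notin> {v}"
      moreover have "N a - C \<subseteq> N v" using Na by blast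
      ultimately have "x = y" if "x \<in> N a - C" "y \<in> N a - C" for x y
        using that common_nbrs_unique[of a v x y] by blast
      then have "card (N a - C) \<le> 1" using finite_N
        by (metis card_le_Suc0_iff_eq finite_Diff One_nat_def)
      then show False using set Na(2) by (auto simp: settled_def)
    qed
  qed
  have "poor C - N v \<subseteq> poor ?C'"
    using poor_lost[of C ?C'] only by blast
  moreover have "N v - C \<subseteq> poor ?C'"
  proof
    fix b assume b: "b \<in> N v - C"
    then have "N b \<inter> saturated C = {}" using N_sym by (auto simp: saturated_def)
    then have "N b \<inter> saturated ?C' \<subseteq> {v}" using only by blast
    then have "card (N b \<inter> saturated ?C') \<le> card {v}" by (intro card_mono) auto
    then show "b \<in> poor ?C'" using b by (auto simp: poor_def)
  qed
  ultimately have "(poor C - N v) \<union> (N v - C) \<subseteq> poor ?C'" by blast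
  then have "card ((poor C - N v) \<union> (N v - C)) \<le> card (poor ?C')"
    using fin finite_N finite_poor by (intro card_mono) auto
  moreover have "card ((poor C - N v) \<union> (N v - C)) = card (poor C - N v) + card (N v - C)"
    using fin finite_N finite_poor by (intro card_Un_disjoint) auto
  moreover have "card (poor C) \<le> card (poor C - N v) + card (N v \<inter> C)"
  proof -
    have "card (poor C) \<le> card ((poor C - N v) \<union> (N v \<inter> C))"
      using fin finite_N finite_poor poor_subset by (intro card_mono) auto
    also have "\<dots> \<le> card (poor C - N v) + card (N v \<inter> C)" by (rule card_Un_le)
    finally show ?thesis .
  qed
  ultimately have grow: "card (poor C) + card (N v - C) \<le> card (poor ?C') + card (N v \<inter> C)"
    by linarith
  have "C \<union> N v = C \<union> (N v - C)" by blast
  then have cardC: "card ?C' = card C + card (N v - C)"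
    using fin finite_N by (metis card_Un_disjoint finite_Diff Diff_disjoint)
  define x where "x = int (card (N v - C))"
  have x: "x \<le> int d" using old old_new deg_le[of v] by (simp add: x_def)
  have "int (card (poor C)) \<le> int (card (poor ?C')) + (int d + 1 - x) - x"
    using grow old_new deg_le[of v] by (simp add: x_def)
  then have "(int d - 1) * int (card (poor C)) \<le> (int d - 1) * (int (card (poor ?C')) + (int d + 1 - x) - x)"
    using d by (intro mult_left_mono) auto
  moreover have "0 \<le> (int d - x) * (int d ^ 2 - int d + 1)"
  proof -
    have "0 \<le> int d ^ 2 - int d" by (simp add: power2_eq_square flip: of_nat_mult)
    then show ?thesis using x by (intro mult_nonneg_nonneg) auto
  qed
  moreover have "balance C k s (poor C)" using pot by (rule potential_weaken)
  ultimately have "balance ?C' (k + 1) s (poor ?C')"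
    unfolding balance_def cardC by (simp add: algebra_simps power2_eq_square power3_eq_cube flip: x_def)
  moreover have "card (?C' - C) \<le> d" using x by (simp add: x_def Un_Diff)
  ultimately show ?thesis using fin finite_N set by (auto simp: potential_def)
qed

text \<open>No vertex is partly reached, so adding \<open>v\<close> saturates nothing, and \<open>|C| - s\<close> is unchanged. The
  set \<open>C\<close> itself becomes the new \<open>C0\<close>; the new vertex \<open>v\<close> gets no credit.\<close>

lemma potential_restart:
  assumes pot: "potential C k s" and v: "v \<notin> C" "N v \<noteq> {}"
    and closed: "\<And>a. N a \<inter> C \<noteq> {} \<Longrightarrow> N a \<subseteq> C"
  shows "potential (insert v C) k (s + 1)"
proof -
  have fin: "finite C" using pot by (simp add: potential_def)
  have set: "settled C"
    unfolding settled_def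
  proof (intro allI impI)
    fix a assume "\<not> N a \<subseteq> C"
    then have "N a - C = N a" "N a \<noteq> {}" using closed by blast+
    then show "2 \<le> card (N a - C)" using deg_ge by simp
  qed
  have same: "saturated (insert v C) = saturated C"
  proof
    show "saturated (insert v C) \<subseteq> saturated C"
    proof
      fix a assume "a \<in> saturated (insert v C)"
      then have a: "N a \<noteq> {}" "N a \<subseteq> insert v C" by (auto simp: saturated_def)
      have "N a \<subseteq> C"
      proof (rule ccontr)
        assume "\<not> N a \<subseteq> C"
        then have "N a \<inter> C = {}" using closed by blast
        then have "N a \<subseteq> {v}" using a by blast
        then have "card (N a) \<le> card {v}" by (intro card_mono) auto
        then show False using deg_ge[OF a(1)] by simp
      qed
      then show "a \<in> saturated C" using a by (simp add: saturated_def)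
    qed
  qed (rule saturated_mono, blast)
  have "poor C \<subseteq> poor (insert v C) \<inter> C" using same by (auto simp: poor_def)
  then have "card (poor C) \<le> card (poor (insert v C) \<inter> C)"
    using fin by (intro card_mono) auto
  then have "(int d - 1) * int (card (poor C)) \<le> (int d - 1) * int (card (poor (insert v C) \<inter> C))"
    using d by (intro mult_left_mono) auto
  moreover have "balance C k s (poor C)" using pot by (rule potential_weaken)
  ultimately have "balance (insert v C) k (s + 1) (poor (insert v C) \<inter> C)"
    using fin v unfolding balance_def by simp
  then show ?thesis using fin set by (auto simp: potential_def)
qed

lemma potential_final:
  assumes pot: "potential C k s" and C: "\<And>b. b \<in> C \<Longrightarrow> N b \<noteq> {}" "\<And>b. b \<in> C \<Longrightarrow> N b \<subseteq> saturated C"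
  shows "(int d ^ 2 + int d - 1) * (int (card C) - int s) \<le> (int d ^ 3 + int d - 1) * int k"
proof -
  have "N b \<inter> saturated C = N b" if "b \<in> C" for b using C(2)[OF that] by blast
  then have "poor C = {}" using C(1) deg_ge by (fastforce simp: poor_def)
  then show ?thesis using potential_weaken[OF pot] by (simp add: balance_def)
qed

text \<open>Its reflexive transitive closure relates vertices on the same side of one component.\<close>

definition two_step :: "('a \<times> 'a) set" where
  "two_step = {(b, b'). \<exists>a. b \<in> N a \<and> b' \<in> N a}"

text \<open>Here \<open>B\<close> is the side of the bipartition in which \<open>C\<close> lives and \<open>R\<close> is the set of the vertices where
  the process was restarted, one per component.\<close>

definition greedy_inv :: "'a set \<Rightarrow> 'a set set \<Rightarrow> bool" where
  "greedy_inv C M \<longleftrightarrow> (\<exists>B R.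
     (\<forall>u v. {u, v} \<in> L \<longrightarrow> (u \<in> B) \<noteq> (v \<in> B)) \<and> C \<subseteq> B \<and> (\<forall>b\<in>C. N b \<noteq> {}) \<and>
     uniquely_restricted L M \<and> \<Union>M \<subseteq> C \<union> saturated C \<and>
     R \<subseteq> C \<and> (\<forall>b\<in>R. \<forall>b'\<in>R. (b, b') \<in> two_step\<^sup>* \<longrightarrow> b = b') \<and>
     potential C (card M) (card R))"

lemma greedy_invE:
  assumes "greedy_inv C M"
  obtains B R where "\<forall>u v. {u, v} \<in> L \<longrightarrow> (u \<in> B) \<noteq> (v \<in> B)" "C \<subseteq> B" "\<forall>b\<in>C. N b \<noteq> {}"
    "uniquely_restricted L M" "\<Union>M \<subseteq> C \<union> saturated C" "R \<subseteq> C"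
    "\<forall>b\<in>R. \<forall>b'\<in>R. (b, b') \<in> two_step\<^sup>* \<longrightarrow> b = b'" "potential C (card M) (card R)"
  using assms unfolding greedy_inv_def by (elim exE conjE) (rule that)

lemma sym_two_step: "sym two_step"
  by (auto simp: two_step_def sym_def)

lemma two_step_closed:
  assumes "\<And>a. N a \<inter> C \<noteq> {} \<Longrightarrow> N a \<subseteq> C" "b \<in> C" "(b, b') \<in> two_step\<^sup>*"
  shows "b' \<in> C"
  using assms(3)
proof induction
  case base
  then show ?case by (rule assms(2))
next
  case (step y z)
  then obtain a where a: "y \<in> N a" "z \<in> N a" by (auto simp: two_step_def)
  then have "N a \<subseteq> C" using step.IH by (intro assms(1)) blast
  then show ?case using a(2) by blast
qed

lemma greedy_inv_independent:
  assumes "greedy_inv C M" "v \<in> C"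
  shows "N v \<inter> C = {}"
proof -
  obtain B where "\<forall>u v. {u, v} \<in> L \<longrightarrow> (u \<in> B) \<noteq> (v \<in> B)" "C \<subseteq> B"
    using assms(1) by (rule greedy_invE)
  then show ?thesis using assms(2) by (auto simp: nbrs_def)
qed

lemma greedy_start:
  assumes "\<And>u v. {u, v} \<in> L \<Longrightarrow> (u \<in> B) \<noteq> (v \<in> B)"
  shows "greedy_inv {} {}"
  unfolding greedy_inv_def
  using assms ur_empty[OF graph] potential_empty
  by (intro exI[of _ B] exI[of _ "{}"]) simp

text \<open>All vertices matched so far are in \<open>C\<close> or saturated. The vertex \<open>w\<close> is adjacent to neither kind:
  it is on the same side as \<open>C\<close>, and saturated vertices have no neighbours outside \<open>C\<close>. So \<open>v\<close> is its only
  possible partner.\<close>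

lemma greedy_augment:
  assumes inv: "greedy_inv C M" and v: "N v \<inter> C \<noteq> {}" and w: "w \<in> N v - C"
    and step: "N v - C = {w} \<or> settled C"
  shows "greedy_inv (C \<union> N v) (insert {v, w} M)" "card (insert {v, w} M) = card M + 1"
proof -
  obtain B R where B0: "\<forall>u v. {u, v} \<in> L \<longrightarrow> (u \<in> B) \<noteq> (v \<in> B)" "C \<subseteq> B" "\<forall>b\<in>C. N b \<noteq> {}"
    and M: "uniquely_restricted L M" "\<Union>M \<subseteq> C \<union> saturated C"
    and R0: "R \<subseteq> C" "\<forall>b\<in>R. \<forall>b'\<in>R. (b, b') \<in> two_step\<^sup>* \<longrightarrow> b = b'" "potential C (card M) (card R)"
    using inv by (rule greedy_invE)
  note B = B0(1)[rule_format] B0(2) B0(3)[rule_format] and R = R0(1) R0(2)[rule_format] R0(3)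
  have NB: "(x \<in> B) \<noteq> (y \<in> B)" if "y \<in> N x" for x y
    using that B(1) by (auto simp: nbrs_def)
  have vB: "v \<notin> B" using v NB B(2) by blast
  have wB: "w \<in> B" using w NB vB by blast
  have v_sat: "v \<notin> saturated C" using w by (auto simp: saturated_def)
  have w_sat: "w \<notin> saturated C" using wB NB B(2) by (fastforce simp: saturated_def)
  have "v \<notin> \<Union>M" using M(2) v_sat vB B(2) by blast
  moreover have "w \<notin> \<Union>M" using M(2) w_sat w by blast
  moreover have "N w \<inter> \<Union>M = {}"
  proof (rule ccontr)
    assume "N w \<inter> \<Union>M \<noteq> {}"
    then obtain x where x: "x \<in> N w" "x \<in> C \<union> saturated C" using M(2) by blast
    then have "x \<notin> C" using wB NB B(2) by blast
    moreover have "w \<in> N x" using x(1) N_sym by blast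
    ultimately show False using x(2) w by (auto simp: saturated_def)
  qed
  moreover have "{v, w} \<in> L" using w by (simp add: nbrs_def)
  ultimately have new: "uniquely_restricted L (insert {v, w} M)" "card (insert {v, w} M) = card M + 1"
    using ur_insert[OF graph M(1)] by auto
  then show "card (insert {v, w} M) = card M + 1" by blast
  have "potential (C \<union> N v) (card M + 1) (card R)"
    using step
  proof
    assume eq: "N v - C = {w}"
    then have "C \<union> N v = insert w C" by blast
    then show ?thesis using potential_forced_step[OF R(3) eq] by simp
  next
    assume "settled C"
    then show ?thesis using potential_branching_step[OF R(3)] v w by blast
  qed
  moreover have "\<Union>(insert {v, w} M) \<subseteq> (C \<union> N v) \<union> saturated (C \<union> N v)"
    using M(2) w saturated_mono[of C "C \<union> N v"] by (auto simp: saturated_def)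
  moreover have "C \<union> N v \<subseteq> B" using B(2) NB vB by blast
  moreover have "N b \<noteq> {}" if "b \<in> C \<union> N v" for b using that B(3) N_sym by blast
  ultimately show "greedy_inv (C \<union> N v) (insert {v, w} M)"
    unfolding greedy_inv_def using new B0(1) R0 le_supI1[OF R(1)]
    by (intro exI[of _ B] exI[of _ R] conjI) simp_all
qed

text \<open>The unexplored part is a union of components. If \<open>v\<close> is on the wrong side of the bipartition, the
  two sides are exchanged on the unexplored part.\<close>

lemma greedy_restart:
  assumes inv: "greedy_inv C M" and v: "v \<notin> C" "N v \<noteq> {}" "N v \<inter> C = {}"
    and closed: "\<And>a. N a \<inter> C \<noteq> {} \<Longrightarrow> N a \<subseteq> C"
  shows "greedy_inv (insert v C) M"
proof -
  obtain B R where B0: "\<forall>u v. {u, v} \<in> L \<longrightarrow> (u \<in> B) \<noteq> (v \<in> B)" "C \<subseteq> B" "\<forall>b\<in>C. N b \<noteq> {}"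
    and M: "uniquely_restricted L M" "\<Union>M \<subseteq> C \<union> saturated C"
    and R0: "R \<subseteq> C" "\<forall>b\<in>R. \<forall>b'\<in>R. (b, b') \<in> two_step\<^sup>* \<longrightarrow> b = b'" "potential C (card M) (card R)"
    using inv by (rule greedy_invE)
  note B = B0(1)[rule_format] B0(2) B0(3)[rule_format] and R = R0(1) R0(2)[rule_format] R0(3)
  have fin: "finite R" using R(1,3) finite_subset by (auto simp: potential_def)
  have colour: "\<exists>B'. (\<forall>x y. {x, y} \<in> L \<longrightarrow> (x \<in> B') \<noteq> (y \<in> B')) \<and> insert v C \<subseteq> B'"
  proof (cases "v \<in> B")
    case True
    then show ?thesis using B by blast
  next
    case False
    define B' where "B' = C \<union> {x. x \<notin> B \<and> N x \<inter> C = {}}"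
    have swap: "x \<in> B' \<and> y \<notin> B' \<or> x \<notin> B' \<and> y \<in> B'" if xy: "{x, y} \<in> L" "x \<in> B" for x y
    proof (cases "x \<in> C")
      case True
      then have "x \<in> N y \<inter> C" "y \<notin> C" using xy B(1,2) by (auto simp: nbrs_def insert_commute)
      then show ?thesis using True by (auto simp: B'_def)
    next
      case False
      then have "x \<in> N y - C" "y \<notin> B" using xy B(1) by (auto simp: nbrs_def insert_commute)
      then have "y \<notin> B" "N y \<inter> C = {}" using closed by blast+
      then show ?thesis using False xy(2) by (auto simp: B'_def)
    qed
    have "(x \<in> B') \<noteq> (y \<in> B')" if "{x, y} \<in> L" for x y
      using swap[of x y] swap[of y x] B(1)[OF that] that by (auto simp: insert_commute)
    moreover have "insert v C \<subseteq> B'" using False v(3) by (auto simp: B'_def)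
    ultimately show ?thesis by blast
  qed
  then obtain B' where B': "\<And>x y. {x, y} \<in> L \<Longrightarrow> (x \<in> B') \<noteq> (y \<in> B')" "insert v C \<subseteq> B'" by blast
  have apart: "(b, v) \<notin> two_step\<^sup>*" "(v, b) \<notin> two_step\<^sup>*" if "b \<in> R" for b
  proof -
    show "(b, v) \<notin> two_step\<^sup>*"
      using two_step_closed[of C b v] closed v(1) that R(1) by blast
    then show "(v, b) \<notin> two_step\<^sup>*"
      using sym_two_step sym_rtrancl by (metis symD)
  qed
  have pairs: "b = b'" if "b \<in> insert v R" "b' \<in> insert v R" "(b, b') \<in> two_step\<^sup>*" for b b'
    using that apart R(2) by blast
  have "card (insert v R) = card R + 1" using fin R(1) v(1) by (subst card_insert_disjoint) auto
  then have "potential (insert v C) (card M) (card (insert v R))"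
    using potential_restart[OF R(3) v(1,2)] closed by simp
  moreover have "\<Union>M \<subseteq> insert v C \<union> saturated (insert v C)"
    using M(2) saturated_mono[of C "insert v C"] by blast
  moreover have "\<forall>b\<in>insert v C. N b \<noteq> {}" using B(3) v(2) by blast
  moreover have "insert v R \<subseteq> insert v C" using R(1) by blast
  ultimately show ?thesis
    unfolding greedy_inv_def using B' M(1) pairs
    by (intro exI[of _ B'] exI[of _ "insert v R"] conjI) simp_all
qed

text \<open>Each edge of a maximum uniquely restricted matching has exactly one end in \<open>C\<close>, and for every
  restart the matching misses a vertex of \<open>C\<close> in the component of that restart.\<close>

lemma greedy_final:
  assumes inv: "greedy_inv C M" and all: "\<And>v. v \<notin> C \<Longrightarrow> N v \<subseteq> C"
  shows "(int d ^ 2 + int d - 1) * int (ur_matching_number L) \<le> (int d ^ 3 + int d - 1) * int (card M)"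
proof -
  obtain B R where B0: "\<forall>u v. {u, v} \<in> L \<longrightarrow> (u \<in> B) \<noteq> (v \<in> B)" "C \<subseteq> B" "\<forall>b\<in>C. N b \<noteq> {}"
    and M: "uniquely_restricted L M" "\<Union>M \<subseteq> C \<union> saturated C"
    and R0: "R \<subseteq> C" "\<forall>b\<in>R. \<forall>b'\<in>R. (b, b') \<in> two_step\<^sup>* \<longrightarrow> b = b'" "potential C (card M) (card R)"
    using inv by (rule greedy_invE)
  note B = B0(1)[rule_format] B0(2) B0(3)[rule_format] and R = R0(1) R0(2)[rule_format] R0(3)
  have indep: "N v \<inter> C = {}" if "v \<in> C" for v using inv that by (rule greedy_inv_independent)
  have finC: "finite C" using R(3) by (simp add: potential_def)
  have sat: "N b \<subseteq> saturated C" if "b \<in> C" for b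
  proof
    fix a assume a: "a \<in> N b"
    then have "a \<notin> C" "b \<in> N a" using indep[OF that] N_sym by blast+
    then show "a \<in> saturated C" using all by (auto simp: saturated_def)
  qed
  obtain X where X: "uniquely_restricted L X" "card X = ur_matching_number L"
    using ur_number_attained[OF graph] by blast
  have mX: "matching L X" using X(1) by (rule ur_matching)
  have "\<exists>x. x \<in> e \<and> x \<in> C" if "e \<in> X" for e
  proof -
    have eL: "e \<in> L" using that mX by (auto simp: matching_def)
    then have "card e = 2" using graph by (auto simp: graph_def)
    then obtain x y where "e = {x, y}" by (auto simp: card_2_iff)
    then show ?thesis using all[of x] eL by (auto simp: nbrs_def)
  qed
  then obtain h where h: "\<And>e. e \<in> X \<Longrightarrow> h e \<in> e \<and> h e \<in> C" by metis
  have "inj_on h X" using h matchingD[OF mX] by (intro inj_onI) metis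
  moreover have "h ` X \<subseteq> C \<inter> \<Union>X" using h by blast
  ultimately have "card X \<le> card (C \<inter> \<Union>X)" using finC by (intro card_inj_on_le) auto
  moreover have "card R \<le> card (C - \<Union>X)"
  proof -
    have "\<exists>x. (b, x) \<in> two_step\<^sup>* \<and> x \<in> C - \<Union>X" if b: "b \<in> R" for b
    proof -
      define K where "K = two_step\<^sup>* `` {b}"
      have meets: "N a \<subseteq> C" if "N a \<inter> C \<noteq> {}" for a
        using that all indep[of a] by blast
      have KC: "K \<subseteq> C" using two_step_closed[of C b] meets b R(1) by (auto simp: K_def)
      have "\<not> K \<subseteq> \<Union>X"
      proof (rule ur_not_covers_closed[OF graph X(1)])
        show "finite K" using KC finC finite_subset by blast
        show "K \<noteq> {}" by (auto simp: K_def)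
        show "N x \<inter> K = {}" if "x \<in> K" for x using that KC indep by blast
        fix x a assume xa: "x \<in> K" "a \<in> N x"
        then have "x \<in> N a" using N_sym by blast
        then show "2 \<le> card (N a)" using deg_ge by blast
        show "N a \<subseteq> K"
        proof
          fix y assume "y \<in> N a"
          then have "(x, y) \<in> two_step" using \<open>x \<in> N a\<close> by (auto simp: two_step_def)
          then show "y \<in> K" using xa(1) by (auto simp: K_def intro: rtrancl_into_rtrancl)
        qed
      qed
      then show ?thesis using KC by (auto simp: K_def)
    qed
    then obtain u where u: "\<And>b. b \<in> R \<Longrightarrow> (b, u b) \<in> two_step\<^sup>* \<and> u b \<in> C - \<Union>X" by metis
    have "inj_on u R"
    proof (rule inj_onI)
      fix b b' assume b: "b \<in> R" "b' \<in> R" "u b = u b'"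
      then have "(u b, b') \<in> two_step\<^sup>*" using u sym_two_step sym_rtrancl by (metis symD)
      then have "(b, b') \<in> two_step\<^sup>*" using u b(1) by (meson rtrancl_trans)
      then show "b = b'" using R(2) b by blast
    qed
    then show ?thesis using u finC by (intro card_inj_on_le[of u]) auto
  qed
  moreover have "card C = card (C \<inter> \<Union>X) + card (C - \<Union>X)" using finC by (rule card_Int_Diff)
  ultimately have "int (ur_matching_number L) \<le> int (card C) - int (card R)" using X(2) by simp
  moreover have "0 \<le> int d ^ 2 + int d - 1"
    using d zero_le_power[of "int d" 2] by linarith
  ultimately have "(int d ^ 2 + int d - 1) * int (ur_matching_number L)
      \<le> (int d ^ 2 + int d - 1) * (int (card C) - int (card R))"
    by (rule mult_left_mono)
  also have "\<dots> \<le> (int d ^ 3 + int d - 1) * int (card M)"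
    using potential_final[OF R(3)] B(3) sat by blast
  finally show ?thesis .
qed

end
section \<open>The marking algorithm\<close>

text \<open>All of the state of the algorithm, apart from the matching, is a marking \<open>m\<close> of the vertices:
  \<open>0\<close> for untouched, \<open>1\<close> for members of \<open>C\<close>, anything larger for vertices deleted by pruning.\<close>

definition live :: "'a set set \<Rightarrow> ('a \<Rightarrow> nat) \<Rightarrow> 'a set set" where
  "live E m = {e \<in> E. \<forall>v\<in>e. m v \<le> 1}"

definition fresh :: "'a set set \<Rightarrow> ('a \<Rightarrow> nat) \<Rightarrow> 'a \<Rightarrow> 'a set" where
  "fresh E m v = {w \<in> nbrs E v. m w = 0}"

definition reached :: "'a set set \<Rightarrow> ('a \<Rightarrow> nat) \<Rightarrow> 'a \<Rightarrow> 'a set" where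
  "reached E m v = {w \<in> nbrs E v. m w = 1}"

text \<open>What remains to be done: a matching of \<open>L\<close> is to be found, to which \<open>K\<close> will be added.\<close>

definition reduction :: "'a set set \<Rightarrow> 'a set set \<Rightarrow> 'a set set \<Rightarrow> bool" where
  "reduction E L K \<longleftrightarrow>
     (\<forall>M. uniquely_restricted L M \<longrightarrow>
        uniquely_restricted E (M \<union> K) \<and> card (M \<union> K) = card M + card K) \<and>
     ur_matching_number E \<le> ur_matching_number L + card K"

locale bounded_bipartite =
  fixes V :: "'a set" and E :: "'a set set" and d :: nat
  assumes graph: "graph V E"
    and C4: "C4_free E"
    and bip: "bipartite V E"
    and deg: "card (nbrs E v) \<le> d + 1"
    and d: "2 \<le> d"
begin

definition pruning :: "('a \<Rightarrow> nat) \<Rightarrow> 'a set set \<Rightarrow> bool" where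
  "pruning m K \<longleftrightarrow> reduction E (live E m) K \<and> (\<forall>v. m v \<noteq> 1)"

definition growing :: "('a \<Rightarrow> nat) \<Rightarrow> 'a set set \<Rightarrow> bool" where
  "growing m K \<longleftrightarrow> pruned_graph V (live E m) d \<and> (\<exists>M K'. K = M \<union> K' \<and> reduction E (live E m) K' \<and>
     pruned_graph.greedy_inv (live E m) d {v. m v = 1} M)"

text \<open>Both phases are run by the same loop, so the invariant is a disjunction. The marks tell the phases
  apart: there is no mark \<open>1\<close> while pruning, and the first restart begins the growing phase.\<close>

definition marking_inv :: "('a \<Rightarrow> nat) \<Rightarrow> 'a set set \<Rightarrow> bool" where
  "marking_inv m K \<longleftrightarrow> pruning m K \<or> growing m K"

lemma live_subset: "live E m \<subseteq> E"
  by (auto simp: live_def)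

lemma graph_live: "graph V (live E m)"
  using graph live_subset by (rule graph_subset)

lemma nbrs_live: "m v \<le> 1 \<Longrightarrow> nbrs (live E m) v = {w \<in> nbrs E v. m w \<le> 1}"
  by (auto simp: nbrs_def live_def)

lemma nbrs_dead: "\<not> m v \<le> 1 \<Longrightarrow> nbrs (live E m) v = {}"
  by (auto simp: nbrs_def live_def)

lemma fresh_eq: "m v \<le> 1 \<Longrightarrow> fresh E m v = nbrs (live E m) v - {v. m v = 1}"
  by (auto simp: fresh_def nbrs_live)

lemma reached_eq: "m v \<le> 1 \<Longrightarrow> reached E m v = nbrs (live E m) v \<inter> {v. m v = 1}"
  by (auto simp: reached_def nbrs_live)

lemma bipartition: "\<exists>B. \<forall>u v. {u, v} \<in> E \<longrightarrow> (u \<in> B) \<noteq> (v \<in> B)"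
proof -
  obtain A B where AB: "A \<inter> B = {}" "\<forall>e\<in>E. \<exists>a\<in>A. \<exists>b\<in>B. e = {a, b}"
    using bip unfolding bipartite_def by (elim exE conjE)
  have "(u \<in> B) \<noteq> (v \<in> B)" if e: "{u, v} \<in> E" for u v
  proof -
    obtain a b where ab: "a \<in> A" "b \<in> B" "{u, v} = {a, b}" using bspec[OF AB(2) e] by (elim bexE)
    have "a \<notin> B" using ab(1) AB(1) by blast
    then show ?thesis using ab(2,3) by (auto simp: doubleton_eq_iff)
  qed
  then show ?thesis by (intro exI[of _ B] allI impI)
qed

lemma reduction_initial: "reduction E E {}"
  by (simp add: reduction_def)

lemma marking_inv_start: "marking_inv (\<lambda>_. 0) {}"
  by (simp add: marking_inv_def pruning_def live_def reduction_initial)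

text \<open>When pruning is exhausted, the live graph has no vertex of degree one.\<close>

lemma pruning_imp_growing:
  assumes "pruning m K" and none: "\<And>v. m v = 0 \<Longrightarrow> card (fresh E m v) \<noteq> 1"
  shows "growing m K"
proof -
  have no1: "m v \<noteq> 1" for v using assms(1) by (simp add: pruning_def)
  have core: "pruned_graph V (live E m) d"
  proof
    show "graph V (live E m)" by (rule graph_live)
    show "C4_free (live E m)" using C4 live_subset unfolding C4_free_def by blast
    show "2 \<le> d" by (rule d)
    fix v
    have "nbrs (live E m) v \<subseteq> nbrs E v" by (auto simp: nbrs_def live_def)
    then have "card (nbrs (live E m) v) \<le> card (nbrs E v)"
      using finite_nbrs[OF graph] by (intro card_mono)
    then show "card (nbrs (live E m) v) \<le> d + 1" using deg le_trans by blast
    assume ne: "nbrs (live E m) v \<noteq> {}"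
    then have "m v \<le> 1" using nbrs_dead by blast
    then have v: "m v = 0" using no1[of v] by linarith
    then have eq: "fresh E m v = nbrs (live E m) v" using no1 by (auto simp: fresh_eq)
    moreover have "card (nbrs (live E m) v) \<noteq> 0" using ne finite_nbrs[OF graph_live] by simp
    ultimately show "2 \<le> card (nbrs (live E m) v)" using none[OF v] by simp
  qed
  obtain B where B: "\<forall>u v. {u, v} \<in> E \<longrightarrow> (u \<in> B) \<noteq> (v \<in> B)" using bipartition by (elim exE)
  have "(u \<in> B) \<noteq> (v \<in> B)" if "{u, v} \<in> live E m" for u v
    using B that by (simp add: live_def)
  then have "pruned_graph.greedy_inv (live E m) d {} {}" by (rule pruned_graph.greedy_start[OF core])
  moreover have "{v. m v = 1} = {}" using no1 by blast
  ultimately show ?thesis using core assms(1) unfolding growing_def pruning_def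
    by (intro conjI exI[of _ "{}"] exI[of _ K]) simp_all
qed

lemma marking_inv_growing:
  assumes "marking_inv m K" "\<And>v. m v = 0 \<Longrightarrow> card (fresh E m v) \<noteq> 1"
  shows "growing m K"
  using assms pruning_imp_growing by (auto simp: marking_inv_def)

text \<open>A vertex with a single live neighbour, this one untouched, has degree one in the live graph. This
  is impossible in the growing phase.\<close>

lemma marking_inv_pendant:
  assumes inv: "marking_inv m K" and v: "m v = 0" "fresh E m v = {w}" "reached E m v = {}"
  shows "marking_inv (m(w := 2)) (insert {v, w} K)"
proof -
  let ?L = "live E m"
  have Nv: "nbrs ?L v = {w}"
    using v fresh_eq[of m v] reached_eq[of m v] by auto
  have "\<not> growing m K"
  proof
    assume "growing m K"
    then have "pruned_graph V ?L d" by (simp add: growing_def)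
    then have "2 \<le> card (nbrs ?L v)" using Nv by (intro pruned_graph.deg_ge) auto
    then show False using Nv by simp
  qed
  then have red: "reduction E ?L K" and no1: "\<forall>v. m v \<noteq> 1"
    using inv by (auto simp: marking_inv_def pruning_def)
  have L': "live E (m(w := 2)) = {e \<in> ?L. w \<notin> e}" by (auto simp: live_def split: if_splits)
  have vw: "{w, v} \<in> ?L" using Nv by (auto simp: nbrs_def insert_commute)
  have "w \<noteq> v" using vw graph_live[of m] by (auto simp: graph_def)
  have ext: "uniquely_restricted ?L (insert {w, v} M) \<and> card (insert {w, v} M) = card M + 1"
    if M: "uniquely_restricted {e \<in> ?L. w \<notin> e} M" for M
  proof -
    have Msub: "M \<subseteq> {e \<in> ?L. w \<notin> e}" using ur_matching[OF M] by (simp add: matching_def)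
    then have "w \<notin> \<Union>M" by blast
    moreover have "v \<notin> \<Union>M"
    proof
      assume "v \<in> \<Union>M"
      then obtain e where e: "e \<in> M" "v \<in> e" by blast
      then obtain z where z: "e = {v, z}" using edge_pair[OF graph_live[of m], of e v] Msub by blast
      then have "z \<in> nbrs ?L v" using e(1) Msub by (auto simp: nbrs_def)
      then show False using Nv z e(1) Msub by auto
    qed
    moreover have "nbrs ?L v \<inter> \<Union>M = {}" using Nv \<open>w \<notin> \<Union>M\<close> by simp
    ultimately show ?thesis
      using ur_insert[OF graph_live[of m] M _ _ vw] by blast
  qed
  have K: "uniquely_restricted E (insert {w, v} M \<union> K) \<and> card (insert {w, v} M \<union> K) = card M + 1 + card K"
    if "uniquely_restricted {e \<in> ?L. w \<notin> e} M" for M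
    using ext[OF that] red unfolding reduction_def by metis
  have "uniquely_restricted {e \<in> ?L. w \<notin> e} {}"
    by (rule ur_empty[OF graph_subset[OF graph_live[of m]]]) auto
  from K[OF this] have cardK: "card (insert {v, w} K) = card K + 1" by (simp add: insert_commute)
  have "reduction E {e \<in> ?L. w \<notin> e} (insert {v, w} K)"
    unfolding reduction_def
  proof (intro conjI allI impI)
    fix M assume M: "uniquely_restricted {e \<in> ?L. w \<notin> e} M"
    have "M \<union> insert {v, w} K = insert {w, v} M \<union> K" by (auto simp: insert_commute)
    then show "uniquely_restricted E (M \<union> insert {v, w} K)"
      "card (M \<union> insert {v, w} K) = card M + card (insert {v, w} K)"
      using K[OF M] cardK by simp_all
  next
    show "ur_matching_number E \<le> ur_matching_number {e \<in> ?L. w \<notin> e} + card (insert {v, w} K)"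
      using red ur_number_delete_vertex[OF graph_live[of m], of w] cardK by (simp add: reduction_def)
  qed
  then have "pruning (m(w := 2)) (insert {v, w} K)"
    using no1 L' by (simp add: pruning_def)
  then show ?thesis by (simp add: marking_inv_def)
qed

text \<open>The test on untouched vertices suffices: a vertex of \<open>C\<close> has all its neighbours outside \<open>C\<close>, and a
  deleted one has no live neighbours.\<close>

lemma growing_settled:
  assumes "pruned_graph V (live E m) d" "pruned_graph.greedy_inv (live E m) d {v. m v = 1} M"
    and none: "\<And>v. m v = 0 \<Longrightarrow> card (fresh E m v) \<noteq> 1"
  shows "pruned_graph.settled (live E m) {v. m v = 1}"
proof -
  interpret pruned_graph V "live E m" d by (rule assms(1))
  show ?thesis
    unfolding settled_def
  proof (intro allI impI)
    fix a assume a: "\<not> N a \<subseteq> {v. m v = 1}"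
    then have "m a \<le> 1" using nbrs_dead by blast
    then consider "m a = 0" | "m a = 1" by linarith
    then show "2 \<le> card (N a - {v. m v = 1})"
    proof cases
      case 1
      then have eq: "fresh E m a = N a - {v. m v = 1}" by (simp add: fresh_eq)
      then have "card (fresh E m a) \<noteq> 0" using a finite_N[of a] by auto
      then show ?thesis using none[OF 1] eq by simp
    next
      case 2
      then have "N a - {v. m v = 1} = N a" using greedy_inv_independent[OF assms(2), of a] by auto
      then show ?thesis using deg_ge[of a] a by auto
    qed
  qed
qed

lemma marking_inv_augment:
  assumes inv: "marking_inv m K" and v: "m v = 0" "w \<in> fresh E m v" "reached E m v \<noteq> {}"
    and step: "fresh E m v = {w} \<or> (\<forall>u. m u = 0 \<longrightarrow> card (fresh E m u) \<noteq> 1)"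
  shows "marking_inv (\<lambda>x. if x \<in> fresh E m v then 1 else m x) (insert {v, w} K)"
proof -
  let ?L = "live E m" and ?C = "{v. m v = 1}" and ?m = "\<lambda>x. if x \<in> fresh E m v then 1 else m x"
  have "growing m K"
    using inv v(3) by (auto simp: marking_inv_def pruning_def reached_def)
  then obtain M K' where K: "K = M \<union> K'" "reduction E ?L K'" and g: "pruned_graph.greedy_inv ?L d ?C M"
    and core: "pruned_graph V ?L d"
    by (auto simp: growing_def)
  have "nbrs ?L v \<inter> ?C \<noteq> {}" using v(1,3) reached_eq[of m v] by simp
  moreover have w: "w \<in> nbrs ?L v - ?C" using v(1,2) fresh_eq[of m v] by simp
  moreover have "nbrs ?L v - ?C = {w} \<or> pruned_graph.settled ?L ?C"
    using step growing_settled[OF core g] fresh_eq[of m v] v(1) by auto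
  ultimately have "pruned_graph.greedy_inv ?L d (?C \<union> nbrs ?L v) (insert {v, w} M)"
    by (intro pruned_graph.greedy_augment[OF core g])
  moreover have "{v. ?m v = 1} = ?C \<union> nbrs ?L v" using v(1) fresh_eq[of m v] by auto
  moreover have "live E ?m = ?L" by (auto simp: live_def fresh_def split: if_splits)
  ultimately have "growing ?m (insert {v, w} K)"
    unfolding growing_def using core K by (intro conjI exI[of _ "insert {v, w} M"] exI[of _ K']) simp_all
  then show ?thesis by (simp add: marking_inv_def)
qed

lemma marking_inv_restart:
  assumes inv: "marking_inv m K" and v: "m v = 0" "fresh E m v \<noteq> {}" "reached E m v = {}"
    and none: "\<And>u. m u = 0 \<Longrightarrow> card (fresh E m u) \<noteq> 1"
    and closed: "\<And>u. m u = 0 \<Longrightarrow> fresh E m u = {} \<or> reached E m u = {}"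
  shows "marking_inv (m(v := 1)) K"
proof -
  let ?L = "live E m" and ?C = "{v. m v = 1}"
  have "growing m K" using inv none by (rule marking_inv_growing)
  then obtain M K' where K: "K = M \<union> K'" "reduction E ?L K'" and g: "pruned_graph.greedy_inv ?L d ?C M"
    and core: "pruned_graph V ?L d"
    by (auto simp: growing_def)
  have "nbrs ?L a \<subseteq> ?C" if a: "nbrs ?L a \<inter> ?C \<noteq> {}" for a
  proof -
    have "a \<notin> ?C" using pruned_graph.greedy_inv_independent[OF core g] a by blast
    moreover have "m a \<le> 1" using a nbrs_dead by blast
    ultimately have 0: "m a = 0" by auto
    then have "fresh E m a = {}" using closed[OF 0] a reached_eq[of m a] by auto
    then show ?thesis using fresh_eq[of m a] 0 by auto
  qed
  moreover have "nbrs ?L v \<noteq> {}" "nbrs ?L v \<inter> ?C = {}"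
    using v fresh_eq[of m v] reached_eq[of m v] by auto
  ultimately have "pruned_graph.greedy_inv ?L d (insert v ?C) M"
    using v(1) by (intro pruned_graph.greedy_restart[OF core g]) auto
  moreover have "{x. (m(v := 1)) x = 1} = insert v ?C" by auto
  moreover have "live E (m(v := 1)) = ?L" using v(1) by (auto simp: live_def split: if_splits)
  ultimately have "growing (m(v := 1)) K"
    unfolding growing_def using core K by (intro conjI exI[of _ M] exI[of _ K']) simp_all
  then show ?thesis by (simp add: marking_inv_def)
qed

lemma marking_inv_final:
  assumes inv: "marking_inv m K" and all: "\<And>v. m v = 0 \<Longrightarrow> fresh E m v = {}"
  shows "uniquely_restricted E K"
    "(int d ^ 2 + int d - 1) * int (ur_matching_number E) \<le> (int d ^ 3 + int d - 1) * int (card K)"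
proof -
  let ?L = "live E m" and ?C = "{v. m v = 1}"
  let ?\<alpha> = "int d ^ 2 + int d - 1" and ?\<beta> = "int d ^ 3 + int d - 1"
  have "growing m K" using inv all by (intro marking_inv_growing) auto
  then obtain M K' where K: "K = M \<union> K'" and red: "reduction E ?L K'" and g: "pruned_graph.greedy_inv ?L d ?C M"
    and core: "pruned_graph V ?L d"
    by (auto simp: growing_def)
  have "uniquely_restricted ?L M"
    using g by (rule pruned_graph.greedy_invE[OF core])
  then have U: "uniquely_restricted E K" "card K = card M + card K'"
    using red K by (simp_all add: reduction_def)
  show "uniquely_restricted E K" by (rule U(1))
  have "nbrs ?L v \<subseteq> ?C" if v: "v \<notin> ?C" for v
  proof (cases "m v = 0")
    case True
    then show ?thesis using all fresh_eq[of m v] by auto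
  next
    case False
    then have "\<not> m v \<le> 1" using v by auto
    then show ?thesis using nbrs_dead by blast
  qed
  then have M: "?\<alpha> * int (ur_matching_number ?L) \<le> ?\<beta> * int (card M)"
    by (rule pruned_graph.greedy_final[OF core g])
  have \<alpha>: "0 \<le> ?\<alpha>" using d zero_le_power[of "int d" 2] by linarith
  have "int d ^ 2 \<le> int d ^ 3" using d by (intro power_increasing) auto
  then have "?\<alpha> \<le> ?\<beta>" by simp
  \<comment> \<open>Each edge taken by pruning accounts for one edge of an optimum; the ratio asks for no more.\<close>
  then have K': "?\<alpha> * int (card K') \<le> ?\<beta> * int (card K')" by (rule mult_right_mono) simp
  have "int (ur_matching_number E) \<le> int (ur_matching_number ?L) + int (card K')"
    using red by (simp add: reduction_def)
  then have "?\<alpha> * int (ur_matching_number E) \<le> ?\<alpha> * (int (ur_matching_number ?L) + int (card K'))"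
    using \<alpha> by (rule mult_left_mono)
  also have "\<dots> \<le> ?\<beta> * int (card M) + ?\<beta> * int (card K')"
    unfolding distrib_left using M K' by (rule add_mono)
  also have "\<dots> = ?\<beta> * int (card K)" using U(2) by (simp add: distrib_left)
  finally show "?\<alpha> * int (ur_matching_number E) \<le> ?\<beta> * int (card K)" .
qed

end
section \<open>Programs with running time bounds\<close>

text \<open>A total correctness triple with step bound \<open>T\<close>; a single initial memory takes the place of the
  precondition.\<close>

definition runs :: "com \<Rightarrow> nat \<Rightarrow> memory \<Rightarrow> (memory \<Rightarrow> bool) \<Rightarrow> bool" where
  "runs c T s Q \<longleftrightarrow> (\<exists>t s'. exec c s t s' \<and> t \<le> T \<and> Q s')"

lemma runsI: "exec c s t s' \<Longrightarrow> t \<le> T \<Longrightarrow> Q s' \<Longrightarrow> runs c T s Q"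
  by (auto simp: runs_def)

lemma runs_weaken:
  "runs c T s Q \<Longrightarrow> T \<le> T' \<Longrightarrow> (\<And>s'. Q s' \<Longrightarrow> Q' s') \<Longrightarrow> runs c T' s Q'"
  unfolding runs_def by (meson le_trans)

lemma runs_Seq:
  assumes "runs c1 T1 s P" "\<And>s'. P s' \<Longrightarrow> runs c2 T2 s' Q"
  shows "runs (Seq c1 c2) (T1 + T2) s Q"
proof -
  obtain t1 s1 where 1: "exec c1 s t1 s1" "t1 \<le> T1" "P s1" using assms(1) by (auto simp: runs_def)
  obtain t2 s2 where 2: "exec c2 s1 t2 s2" "t2 \<le> T2" "Q s2" using assms(2)[OF 1(3)] by (auto simp: runs_def)
  have "t1 + t2 \<le> T1 + T2" using 1(2) 2(2) by simp
  then show ?thesis using exec.Seq[OF 1(1) 2(1)] 2(3) by (auto simp: runs_def)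
qed

lemma runs_Cond:
  assumes "beval b s \<Longrightarrow> runs c1 T1 s Q" "\<not> beval b s \<Longrightarrow> runs c2 T2 s Q"
  shows "runs (Cond b c1 c2) (bcost b + T1 + T2) s Q"
proof (cases "beval b s")
  case True
  then obtain t s' where t: "exec c1 s t s'" "t \<le> T1" "Q s'" using assms(1) by (auto simp: runs_def)
  show ?thesis using exec.CondTrue[OF True t(1)] _ t(3) by (rule runsI) (use t(2) in linarith)
next
  case False
  then obtain t s' where t: "exec c2 s t s'" "t \<le> T2" "Q s'" using assms(2) by (auto simp: runs_def)
  show ?thesis using exec.CondFalse[OF False t(1)] _ t(3) by (rule runsI) (use t(2) in linarith)
qed

text \<open>Programs without loops are executed symbolically. The functions \<open>result\<close> and
  \<open>max_steps\<close> are meant for such programs only; their values on loops are arbitrary.\<close>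

primrec loop_free :: "com \<Rightarrow> bool" where
  "loop_free Skip \<longleftrightarrow> True"
| "loop_free (Assign x i a) \<longleftrightarrow> True"
| "loop_free (Seq c1 c2) \<longleftrightarrow> loop_free c1 \<and> loop_free c2"
| "loop_free (Cond b c1 c2) \<longleftrightarrow> loop_free c1 \<and> loop_free c2"
| "loop_free (While b c) \<longleftrightarrow> False"

primrec result :: "com \<Rightarrow> memory \<Rightarrow> memory" where
  "result Skip s = s"
| "result (Assign x i a) s = s(x := (s x)(aeval i s := aeval a s))"
| "result (Seq c1 c2) s = result c2 (result c1 s)"
| "result (Cond b c1 c2) s = (if beval b s then result c1 s else result c2 s)"
| "result (While b c) s = s"

primrec max_steps :: "com \<Rightarrow> nat" where
  "max_steps Skip = 1"
| "max_steps (Assign x i a) = acost i + acost a + 1"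
| "max_steps (Seq c1 c2) = max_steps c1 + max_steps c2"
| "max_steps (Cond b c1 c2) = bcost b + max_steps c1 + max_steps c2"
| "max_steps (While b c) = 0"

lemma runs_loop_free_result: "loop_free c \<Longrightarrow> runs c (max_steps c) s (\<lambda>s'. s' = result c s)"
proof (induction c arbitrary: s)
  case Skip
  show ?case using exec.Skip by (rule runsI) simp_all
next
  case (Assign x i a)
  show ?case using exec.Assign by (rule runsI) simp_all
next
  case (Seq c1 c2)
  have "runs c1 (max_steps c1) s (\<lambda>s'. s' = result c1 s)" using Seq by simp
  then have "runs (Seq c1 c2) (max_steps c1 + max_steps c2) s (\<lambda>s'. s' = result c2 (result c1 s))"
    by (rule runs_Seq) (use Seq in simp)
  then show ?case by simp
next
  case (Cond b c1 c2)
  have "runs (Cond b c1 c2) (bcost b + max_steps c1 + max_steps c2) s (\<lambda>s'. s' = result (Cond b c1 c2) s)"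
    by (rule runs_Cond) (use Cond in simp_all)
  then show ?case by simp
qed simp

lemma runs_loop_free:
  assumes "loop_free c" "max_steps c \<le> T" "Q (result c s)"
  shows "runs c T s Q"
  using runs_loop_free_result[OF assms(1)] assms(2) by (rule runs_weaken) (use assms(3) in simp)

definition var :: "string \<Rightarrow> aexp" where
  "var x = Cell x (Const 0)"

definition set_var :: "string \<Rightarrow> aexp \<Rightarrow> com" where
  "set_var x a = Assign x (Const 0) a"

definition for_below_n :: "string \<Rightarrow> com \<Rightarrow> com" where
  "for_below_n x c = Seq (set_var x (Const 0))
     (While (Less (var x) (var ''n'')) (Seq c (set_var x (Add (var x) (Const 1)))))"

text \<open>The invariant \<open>I i\<close> describes the memory after the loop variable has been set to \<open>i\<close>. Each round
  costs \<open>5\<close> steps for the test and \<open>6\<close> for the increment, besides the body.\<close>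

lemma runs_for_below_n:
  assumes init: "I 0 (s(x := (s x)(0 := 0)))"
    and size: "\<And>i s. I i s \<Longrightarrow> s ''n'' 0 = n"
    and step: "\<And>i s. i < n \<Longrightarrow> I i s \<Longrightarrow> s x 0 = i \<Longrightarrow>
      runs c T s (\<lambda>s'. s' x 0 = i \<and> I (i + 1) (s'(x := (s' x)(0 := i + 1))))"
    and final: "\<And>s. I n s \<Longrightarrow> Q s"
  shows "runs (for_below_n x c) (n * (T + 11) + 8) s Q"
proof -
  let ?W = "While (Less (var x) (var ''n'')) (Seq c (set_var x (Add (var x) (Const 1))))"
  have loop: "runs ?W (k * (T + 11) + 5) s Q"
    if "i + k = n" "I i s" "s x 0 = i" for i k s
    using that
  proof (induction k arbitrary: i s)
    case 0
    then have "\<not> beval (Less (var x) (var ''n'')) s" using size[OF 0(2)] by (simp add: var_def)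
    from exec.WhileFalse[OF this] have "exec ?W s 5 s" by (simp add: var_def numeral_eq_Suc)
    then show ?case by (rule runsI) (use 0 final in simp_all)
  next
    case (Suc k)
    have i: "i < n" using Suc.prems(1) by simp
    have b: "beval (Less (var x) (var ''n'')) s" using size[OF Suc.prems(2)] Suc.prems(3) i by (simp add: var_def)
    obtain t s1 where 1: "exec c s t s1" "t \<le> T" "s1 x 0 = i" "I (i + 1) (s1(x := (s1 x)(0 := i + 1)))"
      using step[OF i Suc.prems(2,3)] by (auto simp: runs_def)
    let ?s2 = "s1(x := (s1 x)(0 := i + 1))"
    have "exec (set_var x (Add (var x) (Const 1))) s1 6 ?s2"
      using exec.Assign[of x "Const 0" "Add (var x) (Const 1)" s1] 1(3) by (simp add: set_var_def var_def numeral_eq_Suc)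
    then have 2: "exec (Seq c (set_var x (Add (var x) (Const 1)))) s (t + 6) ?s2"
      using 1(1) by (rule exec.Seq[rotated])
    have "runs ?W (k * (T + 11) + 5) ?s2 Q"
    proof (rule Suc.IH)
      show "i + 1 + k = n" using Suc.prems(1) by simp
      show "I (i + 1) ?s2" by (rule 1(4))
    qed simp
    then obtain t3 s3 where 3: "exec ?W ?s2 t3 s3" "t3 \<le> k * (T + 11) + 5" "Q s3" by (auto simp: runs_def)
    have "exec ?W s (5 + (t + 6) + t3) s3"
      using exec.WhileTrue[OF b 2 3(1)] by (simp add: var_def numeral_eq_Suc)
    moreover have "5 + (t + 6) + t3 \<le> Suc k * (T + 11) + 5" using 1(2) 3(2) by simp
    ultimately show ?case using 3(3) by (rule runsI)
  qed
  have "runs (set_var x (Const 0)) 3 s (\<lambda>s'. s' = s(x := (s x)(0 := 0)))"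
    by (rule runs_loop_free) (simp_all add: set_var_def)
  then have "runs (for_below_n x c) (3 + (n * (T + 11) + 5)) s Q"
    unfolding for_below_n_def by (rule runs_Seq) (use loop[of 0 n] init in simp)
  then show ?thesis by (simp add: add.commute add.left_commute)
qed

definition frame :: "string set \<Rightarrow> memory \<Rightarrow> memory \<Rightarrow> bool" where
  "frame B s s' \<longleftrightarrow> (\<forall>b. b \<notin> B \<longrightarrow> s' b = s b)"

lemma frame_refl: "frame B s s"
  by (simp add: frame_def)

lemma frame_trans: "frame B s s' \<Longrightarrow> frame B' s' s'' \<Longrightarrow> B \<subseteq> D \<Longrightarrow> B' \<subseteq> D \<Longrightarrow> frame D s s''"
  unfolding frame_def by (metis subsetD)

lemma frame_upd: "x \<in> B \<Longrightarrow> frame B s (s'(x := f)) \<longleftrightarrow> frame B s s'"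
  by (auto simp: frame_def)

lemma frameD: "frame B s s' \<Longrightarrow> b \<notin> B \<Longrightarrow> s' b = s b"
  by (simp add: frame_def)

section \<open>The program\<close>

text \<open>There is no multiplication, so row \<open>i\<close> of a matrix is found through a table: cell \<open>i\<close> of bank \<open>row\<close>
  contains \<open>i * n\<close>, entered once by repeated addition.\<close>

definition adjacent :: "aexp \<Rightarrow> aexp \<Rightarrow> bexp" where
  "adjacent a b = Less (Const 0) (Cell ''adj'' (Add (Cell ''row'' a) b))"

definition fill_rows :: com where
  "fill_rows = Seq (set_var ''q'' (Const 0))
     (for_below_n ''j'' (Seq (Assign ''row'' (var ''j'') (var ''q''))
                       (set_var ''q'' (Add (var ''q'') (var ''n'')))))"

text \<open>For the vertex in \<open>u\<close>: \<open>x\<close> counts its untouched neighbours, \<open>z\<close> is one of them, and \<open>y\<close> counts its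
  neighbours in \<open>C\<close>.\<close>

definition count_neighbours :: com where
  "count_neighbours = Seq (Seq (set_var ''x'' (Const 0)) (set_var ''y'' (Const 0)))
     (for_below_n ''j''
       (Cond (adjacent (var ''u'') (var ''j''))
         (Cond (Less (Cell ''mark'' (var ''j'')) (Const 1))
           (Seq (set_var ''x'' (Add (var ''x'') (Const 1))) (set_var ''z'' (var ''j'')))
           (Cond (Less (Cell ''mark'' (var ''j'')) (Const 2))
             (set_var ''y'' (Add (var ''y'') (Const 1)))
             Skip))
         Skip))"

text \<open>The rank \<open>q\<close> of the vertex in \<open>u\<close> tells what can be done with it: \<open>3\<close> a pendant edge or a forced
  step, \<open>2\<close> a branching step, \<open>1\<close> a restart, \<open>0\<close> nothing. The higher rank is preferred. The banks
  \<open>rank\<close>, \<open>v\<close>, \<open>w\<close>, \<open>old\<close> keep \<open>q\<close>, \<open>u\<close>, \<open>z\<close>, \<open>y\<close> for the best vertex seen.\<close>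

definition compare_rank :: com where
  "compare_rank = Seq
     (Cond (Less (var ''x'') (Const 1)) (set_var ''q'' (Const 0))
       (Cond (Less (var ''x'') (Const 2)) (set_var ''q'' (Const 3))
         (Cond (Less (Const 0) (var ''y'')) (set_var ''q'' (Const 2)) (set_var ''q'' (Const 1)))))
     (Cond (Less (var ''rank'') (var ''q''))
       (Seq (Seq (set_var ''rank'' (var ''q'')) (set_var ''v'' (var ''u'')))
            (Seq (set_var ''w'' (var ''z'')) (set_var ''old'' (var ''y''))))
       Skip)"

definition find_best :: com where
  "find_best = Seq (set_var ''rank'' (Const 0))
     (for_below_n ''u''
       (Cond (Less (Cell ''mark'' (var ''u'')) (Const 1))
         (Seq count_neighbours compare_rank)
         Skip))"

definition mark_neighbours :: com where
  "mark_neighbours = for_below_n ''j''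
     (Cond (BAnd (adjacent (var ''v'') (var ''j'')) (Less (Cell ''mark'' (var ''j'')) (Const 1)))
       (Assign ''mark'' (var ''j'') (Const 1))
       Skip)"

text \<open>A vertex of rank \<open>3\<close> is at a pendant edge if it has no neighbour in \<open>C\<close>; in this case \<open>w\<close> is
  deleted. The remaining two kinds of steps are treated alike.\<close>

definition use_best :: com where
  "use_best = Cond (Less (Const 1) (var ''rank''))
     (Seq (Assign ''out'' (Add (Cell ''row'' (var ''v'')) (var ''w'')) (Const 1))
       (Cond (BAnd (Less (Const 2) (var ''rank'')) (Less (var ''old'') (Const 1)))
         (Assign ''mark'' (var ''w'') (Const 2))
         mark_neighbours))
     (Cond (Less (Const 0) (var ''rank''))
       (Assign ''mark'' (var ''v'') (Const 1))
       Skip)"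

text \<open>A round that is not idle marks an untouched vertex, so \<open>n\<close> rounds suffice.\<close>

definition ur_program :: com where
  "ur_program = Seq fill_rows (for_below_n ''i'' (Seq find_best use_best))"

definition holds_graph :: "nat \<Rightarrow> nat set set \<Rightarrow> memory \<Rightarrow> bool" where
  "holds_graph n E s \<longleftrightarrow> s ''n'' 0 = n \<and> (\<forall>i<n. s ''row'' i = i * n) \<and>
     (\<forall>i<n. \<forall>j<n. 0 < s ''adj'' (i * n + j) \<longleftrightarrow> {i, j} \<in> E)"

lemma holds_graph_frame:
  "holds_graph n E s \<Longrightarrow> frame B s s' \<Longrightarrow> {''n'', ''row'', ''adj''} \<inter> B = {} \<Longrightarrow> holds_graph n E s'"
  by (auto simp: holds_graph_def frame_def)

lemma matrix_index_inject:
  fixes i j :: nat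
  assumes "j < n" "j' < n" "i * n + j = i' * n + j'"
  shows "i = i' \<and> j = j'"
proof -
  have "(i * n + j) div n = i" "(i * n + j) mod n = j" "(i' * n + j') div n = i'" "(i' * n + j') mod n = j'"
    using assms(1,2) by auto
  then show ?thesis using assms(3) by metis
qed

lemma runs_fill_rows:
  "runs fill_rows (30 * n + 20) (input_memory n E) (\<lambda>s.
     holds_graph n E s \<and> (\<forall>v. s ''mark'' v = 0) \<and> (\<forall>k. s ''out'' k = 0))"
proof -
  let ?m = "input_memory n E"
  let ?I = "\<lambda>i s. frame {''q'', ''j'', ''row''} ?m s \<and> s ''q'' 0 = i * n \<and> (\<forall>k<i. s ''row'' k = k * n)"
  have n: "s ''n'' 0 = n" if "frame {''q'', ''j'', ''row''} ?m s" for s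
    using frameD[OF that, of "''n''"] by (simp add: input_memory_def)
  have "runs (set_var ''q'' (Const 0)) 3 ?m (\<lambda>s. ?I 0 (s(''j'' := (s ''j'')(0 := 0))))"
    by (rule runs_loop_free) (simp_all add: set_var_def frame_upd frame_refl)
  then have "runs fill_rows (3 + (n * (17 + 11) + 8)) ?m (\<lambda>s. ?I n s)"
    unfolding fill_rows_def
  proof (rule runs_Seq)
    fix s assume I0: "?I 0 (s(''j'' := (s ''j'')(0 := 0)))"
    show "runs (for_below_n ''j'' (Seq (Assign ''row'' (var ''j'') (var ''q''))
                       (set_var ''q'' (Add (var ''q'') (var ''n''))))) (n * (17 + 11) + 8) s (\<lambda>s. ?I n s)"
    proof (rule runs_for_below_n[where I = ?I])
      fix i s assume "i < n" "?I i s" "s ''j'' 0 = i"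
      then show "runs (Seq (Assign ''row'' (var ''j'') (var ''q''))
                       (set_var ''q'' (Add (var ''q'') (var ''n'')))) 17 s
         (\<lambda>s'. s' ''j'' 0 = i \<and> ?I (i + 1) (s'(''j'' := (s' ''j'')(0 := i + 1))))"
        using n by (intro runs_loop_free) (auto simp: set_var_def var_def frame_upd less_Suc_eq)
    qed (use I0 n in simp_all)
  qed
  then show ?thesis
  proof (rule runs_weaken)
    fix s assume I: "?I n s"
    then have fr: "s b = ?m b" if "b \<notin> {''q'', ''j'', ''row''}" for b using that by (simp add: frame_def)
    have "0 < s ''adj'' (i * n + j) \<longleftrightarrow> {i, j} \<in> E" if "i < n" "j < n" for i j
    proof
      assume "0 < s ''adj'' (i * n + j)"
      then have "\<exists>i'<n. \<exists>j'<n. i * n + j = i' * n + j' \<and> {i', j'} \<in> E"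
        using fr[of "''adj''"] by (simp add: input_memory_def split: if_splits) blast
      then show "{i, j} \<in> E" using matrix_index_inject[OF that(2)] by metis
    next
      assume "{i, j} \<in> E"
      then show "0 < s ''adj'' (i * n + j)"
        using fr[of "''adj''"] that by (auto simp: input_memory_def)
    qed
    moreover have "s ''mark'' v = 0" "s ''out'' v = 0" for v
      using fr[of "''mark''"] fr[of "''out''"] by (simp_all add: input_memory_def)
    ultimately show "holds_graph n E s \<and> (\<forall>v. s ''mark'' v = 0) \<and> (\<forall>k. s ''out'' k = 0)"
      using I n by (simp add: holds_graph_def)
  qed simp
qed

lemma beval_adjacent:
  assumes "holds_graph n E s" "s a 0 = i" "s b 0 = j" "i < n" "j < n"
  shows "beval (adjacent (var a) (var b)) s \<longleftrightarrow> j \<in> nbrs E i"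
  using assms by (simp add: holds_graph_def adjacent_def var_def nbrs_def)

lemma card_below_Suc:
  assumes "finite F"
  shows "card {w \<in> F. w < Suc k} = card {w \<in> F. w < k} + (if k \<in> F then 1 else 0)"
proof -
  have "{w \<in> F. w < Suc k} = (if k \<in> F then insert k {w \<in> F. w < k} else {w \<in> F. w < k})"
    by (auto simp: less_Suc_eq)
  then show ?thesis using assms by simp
qed

lemma nbrs_less:
  fixes E :: "nat set set"
  assumes "graph {..<n} E" "w \<in> nbrs E v"
  shows "w < n" "v < n"
  using assms by (auto simp: graph_def nbrs_def)

lemma runs_count_neighbours:
  assumes G: "graph {..<n} E" and s: "holds_graph n E s" and u: "s ''u'' 0 = u" "u < n"
    and m: "s ''mark'' = m"
  shows "runs count_neighbours (100 * n + 50) s (\<lambda>s'. frame {''x'', ''y'', ''z'', ''j''} s s' \<and>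
    s' ''x'' 0 = card (fresh E m u) \<and> s' ''y'' 0 = card (reached E m u) \<and>
    (fresh E m u \<noteq> {} \<longrightarrow> s' ''z'' 0 \<in> fresh E m u))"
proof -
  let ?B = "{''x'', ''y'', ''z'', ''j''}" and ?F = "fresh E m u" and ?R = "reached E m u"
  let ?I = "\<lambda>k s'. frame ?B s s' \<and> s' ''x'' 0 = card {w \<in> ?F. w < k} \<and>
     s' ''y'' 0 = card {w \<in> ?R. w < k} \<and> ({w \<in> ?F. w < k} \<noteq> {} \<longrightarrow> s' ''z'' 0 \<in> ?F)"
  let ?c = "Cond (adjacent (var ''u'') (var ''j''))
         (Cond (Less (Cell ''mark'' (var ''j'')) (Const 1))
           (Seq (set_var ''x'' (Add (var ''x'') (Const 1))) (set_var ''z'' (var ''j'')))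
           (Cond (Less (Cell ''mark'' (var ''j'')) (Const 2))
             (set_var ''y'' (Add (var ''y'') (Const 1)))
             Skip))
         Skip"
  have fin: "finite ?F" "finite ?R"
    using finite_nbrs[OF G] by (auto simp: fresh_def reached_def)
  have all: "{w \<in> ?F. w < n} = ?F" "{w \<in> ?R. w < n} = ?R"
    using nbrs_less(1)[OF G] by (auto simp: fresh_def reached_def)
  have "runs (Seq (set_var ''x'' (Const 0)) (set_var ''y'' (Const 0))) 6 s
      (\<lambda>s'. ?I 0 (s'(''j'' := (s' ''j'')(0 := 0))))"
    by (rule runs_loop_free) (simp_all add: set_var_def frame_upd frame_refl)
  then have "runs count_neighbours (6 + (n * (60 + 11) + 8)) s (\<lambda>s'. ?I n s')"
    unfolding count_neighbours_def
  proof (rule runs_Seq)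
    fix s1 assume I0: "?I 0 (s1(''j'' := (s1 ''j'')(0 := 0)))"
    show "runs (for_below_n ''j'' ?c) (n * (60 + 11) + 8) s1 (\<lambda>s'. ?I n s')"
    proof (rule runs_for_below_n[where I = ?I])
      fix k s' assume "?I k s'"
      then have "s' ''n'' = s ''n''" by (simp add: frame_def)
      then show "s' ''n'' 0 = n" using s by (simp add: holds_graph_def)
    next
      fix k s' assume k: "k < n" and I: "?I k s'" and j: "s' ''j'' 0 = k"
      have fr: "frame ?B s s'" using I by simp
      have "holds_graph n E s'" using s fr by (rule holds_graph_frame) simp
      moreover have u': "s' ''u'' 0 = u" using frameD[OF fr, of "''u''"] u(1) by simp
      ultimately have adj: "beval (adjacent (var ''u'') (var ''j'')) s' \<longleftrightarrow> k \<in> nbrs E u"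
        using j u(2) k by (intro beval_adjacent)
      have mk: "s' ''mark'' = m" using frameD[OF fr, of "''mark''"] m by simp
      show "runs ?c 60 s' (\<lambda>s2. s2 ''j'' 0 = k \<and> ?I (k + 1) (s2(''j'' := (s2 ''j'')(0 := k + 1))))"
      proof (rule runs_loop_free)
        have F: "k \<in> ?F \<longleftrightarrow> k \<in> nbrs E u \<and> m k < 1" and R: "k \<in> ?R \<longleftrightarrow> k \<in> nbrs E u \<and> \<not> m k < 1 \<and> m k < 2"
          by (auto simp: fresh_def reached_def)
        have ne: "{w \<in> ?F. w < Suc k} \<noteq> {} \<longleftrightarrow> {w \<in> ?F. w < k} \<noteq> {} \<or> k \<in> ?F"
          by (auto simp: less_Suc_eq)
        have cF: "card {w \<in> ?F. w < Suc k} = card {w \<in> ?F. w < k} + (if k \<in> ?F then 1 else 0)"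
          using fin(1) by (rule card_below_Suc)
        have cR: "card {w \<in> ?R. w < Suc k} = card {w \<in> ?R. w < k} + (if k \<in> ?R then 1 else 0)"
          using fin(2) by (rule card_below_Suc)
        consider "k \<in> ?F" "k \<notin> ?R" | "k \<notin> ?F" "k \<in> ?R" | "k \<notin> ?F" "k \<notin> ?R" using F R by blast
        then show "result ?c s' ''j'' 0 = k \<and>
          ?I (k + 1) ((result ?c s')(''j'' := (result ?c s' ''j'')(0 := k + 1)))"
        proof cases
          case 1
          then have "k \<in> nbrs E u" "m k < 1" using F by auto
          then have "result ?c s' = result (Seq (set_var ''x'' (Add (var ''x'') (Const 1))) (set_var ''z'' (var ''j''))) s'"
            using adj mk j by (simp add: var_def)
          then show ?thesis using 1 I j cF cR ne by (simp add: set_var_def var_def frame_upd)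
        next
          case 2
          then have "k \<in> nbrs E u" "\<not> m k < 1" "m k < 2" using R by auto
          then have "result ?c s' = result (set_var ''y'' (Add (var ''y'') (Const 1))) s'"
            using adj mk j by (simp add: var_def)
          then show ?thesis using 2 I j cF cR ne by (simp add: set_var_def var_def frame_upd)
        next
          case 3
          then have "k \<notin> nbrs E u \<or> \<not> m k < 1 \<and> \<not> m k < 2" using F R by auto
          then have "result ?c s' = s'" using adj mk j by (auto simp: var_def)
          then show ?thesis using 3 I j cF cR ne by (simp add: frame_upd)
        qed
      qed (simp_all add: adjacent_def set_var_def var_def)
    qed (use I0 in simp_all)
  qed
  then show ?thesis by (rule runs_weaken) (use all in simp_all)
qed

text \<open>The number computed by \<open>compare_rank\<close>, with rank \<open>0\<close> for vertices already marked.\<close>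

definition vertex_rank :: "'a set set \<Rightarrow> ('a \<Rightarrow> nat) \<Rightarrow> 'a \<Rightarrow> nat" where
  "vertex_rank E m v =
     (if m v \<noteq> 0 \<or> card (fresh E m v) = 0 then 0
      else if card (fresh E m v) = 1 then 3
      else if reached E m v \<noteq> {} then 2 else 1)"

definition best_below :: "nat set set \<Rightarrow> (nat \<Rightarrow> nat) \<Rightarrow> nat \<Rightarrow> memory \<Rightarrow> bool" where
  "best_below E m k s \<longleftrightarrow> (\<forall>u<k. vertex_rank E m u \<le> s ''rank'' 0) \<and>
     (0 < s ''rank'' 0 \<longrightarrow> s ''v'' 0 < k \<and> m (s ''v'' 0) = 0 \<and>
        vertex_rank E m (s ''v'' 0) = s ''rank'' 0 \<and> s ''w'' 0 \<in> fresh E m (s ''v'' 0) \<and>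
        s ''old'' 0 = card (reached E m (s ''v'' 0)))"

lemma best_below_upd:
  "x \<notin> {''rank'', ''v'', ''w'', ''old''} \<Longrightarrow> best_below E m k (s(x := f)) \<longleftrightarrow> best_below E m k s"
  by (auto simp: best_below_def)

lemma best_below_skip:
  "best_below E m k s \<Longrightarrow> vertex_rank E m k \<le> s ''rank'' 0 \<Longrightarrow> best_below E m (Suc k) s"
  by (auto simp: best_below_def less_Suc_eq)

lemma runs_compare_rank:
  assumes G: "graph {..<n} E" and u: "s ''u'' 0 = u" "m u = 0"
    and x: "s ''x'' 0 = card (fresh E m u)" and y: "s ''y'' 0 = card (reached E m u)"
    and z: "fresh E m u \<noteq> {} \<longrightarrow> s ''z'' 0 \<in> fresh E m u"
    and best: "best_below E m u s"
  shows "runs compare_rank 100 s (\<lambda>s'. frame {''q'', ''rank'', ''v'', ''w'', ''old''} s s' \<and>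
    best_below E m (Suc u) s')"
proof (rule runs_loop_free)
  let ?q = "vertex_rank E m u"
  let ?c1 = "Cond (Less (var ''x'') (Const 1)) (set_var ''q'' (Const 0))
       (Cond (Less (var ''x'') (Const 2)) (set_var ''q'' (Const 3))
         (Cond (Less (Const 0) (var ''y'')) (set_var ''q'' (Const 2)) (set_var ''q'' (Const 1))))"
  let ?c2 = "Cond (Less (var ''rank'') (var ''q''))
       (Seq (Seq (set_var ''rank'' (var ''q'')) (set_var ''v'' (var ''u'')))
            (Seq (set_var ''w'' (var ''z'')) (set_var ''old'' (var ''y''))))
       Skip"
  have fin: "finite (reached E m u)" "finite (fresh E m u)"
    using finite_nbrs[OF G] by (auto simp: fresh_def reached_def)
  define s1 where "s1 = s(''q'' := (s ''q'')(0 := ?q))"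
  have y0: "s ''y'' 0 = 0 \<longleftrightarrow> reached E m u = {}" using y fin by simp
  have 1: "result ?c1 s = s1"
  proof -
    consider "card (fresh E m u) = 0" | "card (fresh E m u) = 1" | "2 \<le> card (fresh E m u)" by linarith
    then show ?thesis
      using x y0 u(2) by cases (auto simp: vertex_rank_def set_var_def var_def s1_def)
  qed
  have best1: "best_below E m u s1" using best by (simp add: s1_def best_below_upd)
  have "frame {''q'', ''rank'', ''v'', ''w'', ''old''} s (result ?c2 s1) \<and> best_below E m (Suc u) (result ?c2 s1)"
  proof (cases "s ''rank'' 0 < ?q")
    case True
    then have "fresh E m u \<noteq> {}" by (auto simp: vertex_rank_def split: if_splits)
    moreover have "vertex_rank E m t \<le> ?q" if "t < Suc u" for t
    proof (cases "t = u")
      case False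
      then have "t < u" using that by simp
      then have "vertex_rank E m t \<le> s ''rank'' 0" using best by (simp add: best_below_def)
      then show ?thesis using True by simp
    qed simp
    ultimately show ?thesis using True u y z
      by (simp add: best_below_def set_var_def var_def s1_def frame_upd frame_refl)
  next
    case False
    then have "result ?c2 s1 = s1" by (simp add: s1_def var_def)
    moreover have "best_below E m (Suc u) s1"
      using best1 False by (intro best_below_skip) (simp_all add: s1_def)
    ultimately show ?thesis by (simp add: s1_def frame_upd frame_refl)
  qed
  then show "frame {''q'', ''rank'', ''v'', ''w'', ''old''} s (result compare_rank s) \<and>
    best_below E m (Suc u) (result compare_rank s)"
    unfolding compare_rank_def result.simps(3) 1 .
qed (simp_all add: compare_rank_def set_var_def var_def)

lemma runs_find_best:
  assumes G: "graph {..<n} E" and s: "holds_graph n E s" and m: "s ''mark'' = m"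
  shows "runs find_best (n * (100 * n + 200) + 20) s (\<lambda>s'.
    frame {''rank'', ''u'', ''x'', ''y'', ''z'', ''j'', ''q'', ''v'', ''w'', ''old''} s s' \<and> best_below E m n s')"
proof -
  let ?B = "{''rank'', ''u'', ''x'', ''y'', ''z'', ''j'', ''q'', ''v'', ''w'', ''old''}"
  let ?I = "\<lambda>k s'. frame ?B s s' \<and> best_below E m k s'"
  let ?c = "Cond (Less (Cell ''mark'' (var ''u'')) (Const 1)) (Seq count_neighbours compare_rank) Skip"
  have "runs (set_var ''rank'' (Const 0)) 3 s (\<lambda>s'. ?I 0 (s'(''u'' := (s' ''u'')(0 := 0))))"
    by (rule runs_loop_free) (simp_all add: set_var_def frame_upd frame_refl best_below_def)
  then have "runs find_best (3 + (n * ((100 * n + 160) + 11) + 8)) s (\<lambda>s'. ?I n s')"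
    unfolding find_best_def
  proof (rule runs_Seq)
    fix s1 assume I0: "?I 0 (s1(''u'' := (s1 ''u'')(0 := 0)))"
    show "runs (for_below_n ''u'' ?c) (n * ((100 * n + 160) + 11) + 8) s1 (\<lambda>s'. ?I n s')"
    proof (rule runs_for_below_n[where I = ?I])
      fix k s' assume "?I k s'"
      then have "s' ''n'' = s ''n''" by (simp add: frame_def)
      then show "s' ''n'' 0 = n" using s by (simp add: holds_graph_def)
    next
      fix k s' assume k: "k < n" and I: "?I k s'" and u: "s' ''u'' 0 = k"
      have fr: "frame ?B s s'" using I by simp
      have g': "holds_graph n E s'" using s fr by (rule holds_graph_frame) simp
      have mk: "s' ''mark'' = m" using frameD[OF fr, of "''mark''"] m by simp
      let ?Q = "\<lambda>s2. s2 ''u'' 0 = k \<and> ?I (k + 1) (s2(''u'' := (s2 ''u'')(0 := k + 1)))"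
      have "runs ?c (bcost (Less (Cell ''mark'' (var ''u'')) (Const 1)) + (100 * n + 50 + 100) + 1) s' ?Q"
      proof (rule runs_Cond)
        assume "beval (Less (Cell ''mark'' (var ''u'')) (Const 1)) s'"
        then have mk0: "m k = 0" using mk u by (simp add: var_def)
        show "runs (Seq count_neighbours compare_rank) (100 * n + 50 + 100) s' ?Q"
          using runs_count_neighbours[OF G g' u k mk]
        proof (rule runs_Seq)
          fix s2 assume s2: "frame {''x'', ''y'', ''z'', ''j''} s' s2 \<and> s2 ''x'' 0 = card (fresh E m k) \<and>
            s2 ''y'' 0 = card (reached E m k) \<and> (fresh E m k \<noteq> {} \<longrightarrow> s2 ''z'' 0 \<in> fresh E m k)"
          then have f2: "frame {''x'', ''y'', ''z'', ''j''} s' s2" by simp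
          have "best_below E m k s2"
            using I frameD[OF f2, of "''rank''"] frameD[OF f2, of "''v''"] frameD[OF f2, of "''w''"]
              frameD[OF f2, of "''old''"] by (simp add: best_below_def)
          moreover have "s2 ''u'' 0 = k" using frameD[OF f2, of "''u''"] u by simp
          ultimately have "runs compare_rank 100 s2
             (\<lambda>s3. frame {''q'', ''rank'', ''v'', ''w'', ''old''} s2 s3 \<and> best_below E m (Suc k) s3)"
            using s2 mk0 by (intro runs_compare_rank[OF G]) auto
          then show "runs compare_rank 100 s2 ?Q"
          proof (rule runs_weaken)
            fix s3 assume s3: "frame {''q'', ''rank'', ''v'', ''w'', ''old''} s2 s3 \<and> best_below E m (Suc k) s3"
            then have f3: "frame {''q'', ''rank'', ''v'', ''w'', ''old''} s2 s3" by simp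
            have "frame ?B s s2" using fr f2 by (rule frame_trans) auto
            then have "frame ?B s s3" using f3 by (rule frame_trans) auto
            moreover have "s3 ''u'' 0 = k" using frameD[OF f3, of "''u''"] \<open>s2 ''u'' 0 = k\<close> by simp
            ultimately show "?Q s3" using s3 by (simp add: frame_upd best_below_upd)
          qed simp
        qed
      next
        assume "\<not> beval (Less (Cell ''mark'' (var ''u'')) (Const 1)) s'"
        then have "vertex_rank E m k = 0" using mk u by (simp add: var_def vertex_rank_def)
        then have "best_below E m (Suc k) s'" using I by (intro best_below_skip) simp_all
        then show "runs Skip 1 s' ?Q"
          using I u by (intro runs_loop_free) (simp_all add: frame_upd best_below_upd)
      qed
      then show "runs ?c (100 * n + 160) s' ?Q"
        by (rule runs_weaken) (simp_all add: var_def)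
    qed (use I0 in simp_all)
  qed
  then show ?thesis by (rule runs_weaken) (simp_all add: algebra_simps)
qed

lemma runs_mark_neighbours:
  assumes G: "graph {..<n} E" and s: "holds_graph n E s" and v: "s ''v'' 0 = v" "v < n"
    and m: "s ''mark'' = m"
  shows "runs mark_neighbours (100 * n + 8) s (\<lambda>s'. frame {''mark'', ''j''} s s' \<and>
    s' ''mark'' = (\<lambda>x. if x \<in> fresh E m v then 1 else m x))"
proof -
  let ?F = "fresh E m v"
  let ?I = "\<lambda>k s'. frame {''mark'', ''j''} s s' \<and> s' ''mark'' = (\<lambda>x. if x \<in> ?F \<and> x < k then 1 else m x)"
  let ?c = "Cond (BAnd (adjacent (var ''v'') (var ''j'')) (Less (Cell ''mark'' (var ''j'')) (Const 1)))
       (Assign ''mark'' (var ''j'') (Const 1)) Skip"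
  have all: "x \<in> ?F \<and> x < n \<longleftrightarrow> x \<in> ?F" for x
    using nbrs_less(1)[OF G] by (auto simp: fresh_def)
  have "runs mark_neighbours (n * (30 + 11) + 8) s (\<lambda>s'. ?I n s')"
    unfolding mark_neighbours_def
  proof (rule runs_for_below_n[where I = ?I])
    show "?I 0 (s(''j'' := (s ''j'')(0 := 0)))" using m by (simp add: frame_upd frame_refl)
  next
    fix k s' assume "?I k s'"
    then have "s' ''n'' = s ''n''" by (simp add: frame_def)
    then show "s' ''n'' 0 = n" using s by (simp add: holds_graph_def)
  next
    fix k s' assume k: "k < n" and I: "?I k s'" and j: "s' ''j'' 0 = k"
    have fr: "frame {''mark'', ''j''} s s'" using I by simp
    have "holds_graph n E s'" using s fr by (rule holds_graph_frame) simp
    moreover have "s' ''v'' 0 = v" using frameD[OF fr, of "''v''"] v(1) by simp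
    ultimately have adj: "beval (adjacent (var ''v'') (var ''j'')) s' \<longleftrightarrow> k \<in> nbrs E v"
      using j v(2) k by (intro beval_adjacent)
    have mk: "s' ''mark'' = (\<lambda>x. if x \<in> ?F \<and> x < k then 1 else m x)" using I by simp
    show "runs ?c 30 s' (\<lambda>s2. s2 ''j'' 0 = k \<and> ?I (k + 1) (s2(''j'' := (s2 ''j'')(0 := k + 1))))"
    proof (rule runs_loop_free)
      have F: "beval (BAnd (adjacent (var ''v'') (var ''j'')) (Less (Cell ''mark'' (var ''j'')) (Const 1))) s'
          \<longleftrightarrow> k \<in> ?F"
        using adj mk j by (simp add: var_def fresh_def)
      have "result ?c s' ''mark'' = (\<lambda>x. if x \<in> ?F \<and> x < k + 1 then 1 else m x)"
      proof (cases "k \<in> ?F")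
        case True
        then have "result ?c s' ''mark'' = (s' ''mark'')(k := 1)" using F j by (simp add: var_def)
        then show ?thesis using mk True by (auto simp: fun_eq_iff less_Suc_eq)
      next
        case False
        then have "\<not> beval (BAnd (adjacent (var ''v'') (var ''j'')) (Less (Cell ''mark'' (var ''j'')) (Const 1))) s'"
          using F by blast
        then have "result ?c s' ''mark'' = s' ''mark''" by (simp only: result.simps if_False)
        then show ?thesis using mk False by (auto simp: fun_eq_iff less_Suc_eq)
      qed
      moreover have "result ?c s' ''j'' 0 = k" using j by simp
      moreover have "frame {''mark'', ''j''} s (result ?c s')" using fr by (simp add: frame_upd)
      ultimately show "result ?c s' ''j'' 0 = k \<and>
          ?I (k + 1) ((result ?c s')(''j'' := (result ?c s' ''j'')(0 := k + 1)))"
        by (simp add: frame_upd)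
    qed (simp_all add: adjacent_def var_def)
  qed simp
  then show ?thesis by (rule runs_weaken) (use all in simp_all)
qed

lemma output_edges_frame:
  "frame B s s' \<Longrightarrow> ''out'' \<notin> B \<Longrightarrow> output_edges n s' = output_edges n s"
  by (simp add: output_edges_def frame_def)

lemma output_edges_add:
  assumes "v < n" "w < n" "a \<noteq> 0"
  shows "output_edges n (s(''out'' := (s ''out'')(v * n + w := a))) = insert {v, w} (output_edges n s)"
proof -
  have "(s(''out'' := (s ''out'')(v * n + w := a))) ''out'' (i * n + j) \<noteq> 0 \<longleftrightarrow>
      i = v \<and> j = w \<or> s ''out'' (i * n + j) \<noteq> 0" if "i < n" "j < n" for i j
    using matrix_index_inject[OF that(2) assms(2)] assms(3) by (auto simp: fun_upd_apply)
  then show ?thesis using assms(1,2) unfolding output_edges_def by blast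
qed

definition unmarked :: "nat \<Rightarrow> (nat \<Rightarrow> nat) \<Rightarrow> nat set" where
  "unmarked n m = {v. v < n \<and> m v = 0}"

lemma unmarked_decreases:
  assumes "v < n" "m v = 0" "m' v \<noteq> 0" "\<And>x. m' x = 0 \<Longrightarrow> m x = 0"
  shows "card (unmarked n m') < card (unmarked n m)"
proof (rule psubset_card_mono)
  show "finite (unmarked n m)" by (simp add: unmarked_def)
  have "v \<in> unmarked n m - unmarked n m'" using assms(1-3) by (simp add: unmarked_def)
  moreover have "unmarked n m' \<subseteq> unmarked n m" using assms(4) by (auto simp: unmarked_def)
  ultimately show "unmarked n m' \<subset> unmarked n m" by blast
qed

definition finished :: "'a set set \<Rightarrow> ('a \<Rightarrow> nat) \<Rightarrow> bool" where
  "finished E m \<longleftrightarrow> (\<forall>u. m u = 0 \<longrightarrow> fresh E m u = {})"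

context
  fixes n :: nat and E :: "nat set set" and d :: nat
  assumes input: "bounded_bipartite {..<n} E d"
begin

interpretation bounded_bipartite "{..<n}" E d by (rule input)

lemma rank_zero: "vertex_rank E m v = 0 \<Longrightarrow> m v = 0 \<Longrightarrow> fresh E m v = {}"
  using finite_nbrs[OF graph, of v] by (auto simp: vertex_rank_def fresh_def split: if_splits)

lemma fresh_outside: "\<not> v < n \<Longrightarrow> fresh E m v = {}"
  using nbrs_less(2)[OF graph] by (auto simp: fresh_def)

text \<open>The maximality of the rank supplies the conditions under which a step may be taken: below rank \<open>3\<close>
  there is no vertex with exactly one untouched neighbour, and below rank \<open>2\<close> no vertex has both an
  untouched neighbour and one in \<open>C\<close>.\<close>

lemma runs_use_best:
  assumes s: "holds_graph n E s" and m: "s ''mark'' = m" and inv: "marking_inv m (output_edges n s)"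
    and best: "best_below E m n s" and pos: "0 < s ''rank'' 0"
  shows "runs use_best (100 * n + 100) s (\<lambda>s'. frame {''mark'', ''out'', ''j''} s s' \<and>
    marking_inv (s' ''mark'') (output_edges n s') \<and> card (unmarked n (s' ''mark'')) < card (unmarked n m))"
proof -
  define v w r where "v = s ''v'' 0" and "w = s ''w'' 0" and "r = s ''rank'' 0"
  note vwr = v_def w_def r_def
  let ?K = "output_edges n s"
  have v: "v < n" "m v = 0" "vertex_rank E m v = r" "w \<in> fresh E m v" "s ''old'' 0 = card (reached E m v)"
    and max: "\<And>u. u < n \<Longrightarrow> vertex_rank E m u \<le> r"
    using best pos by (auto simp: best_below_def vwr)
  have fin: "finite (fresh E m u)" "finite (reached E m u)" for u
    using finite_nbrs[OF graph] by (auto simp: fresh_def reached_def)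
  have w: "w < n" "m w = 0" using v(4) nbrs_less(1)[OF graph] by (auto simp: fresh_def)
  have row: "s ''row'' v = v * n" using s v(1) by (simp add: holds_graph_def)
  have old: "s ''old'' 0 < 1 \<longleftrightarrow> reached E m v = {}" using v(5) fin by simp
  have none: "card (fresh E m u) \<noteq> 1" if "r < 3" "m u = 0" for u
  proof (cases "u < n")
    case True
    then have "vertex_rank E m u \<noteq> 3" using max that(1) by fastforce
    then show ?thesis using that(2) by (auto simp: vertex_rank_def)
  qed (simp add: fresh_outside)
  have closed: "fresh E m u = {} \<or> reached E m u = {}" if "r < 2" "m u = 0" for u
  proof (cases "u < n")
    case True
    then have "vertex_rank E m u < 2" using max that(1) by fastforce
    then show ?thesis using that(2) fin(1)[of u] by (auto simp: vertex_rank_def split: if_splits)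
  qed (simp add: fresh_outside)
  have three: "fresh E m v = {w}" if "2 < r"
  proof -
    have "card (fresh E m v) = 1" using that v(3) by (auto simp: vertex_rank_def split: if_splits)
    then show ?thesis using v(4) by (auto simp: card_1_singleton_iff)
  qed
  let ?Q = "\<lambda>s'. frame {''mark'', ''out'', ''j''} s s' \<and>
    marking_inv (s' ''mark'') (output_edges n s') \<and> card (unmarked n (s' ''mark'')) < card (unmarked n m)"
  let ?a = "Add (Cell ''row'' (var ''v'')) (var ''w'')"
  let ?b1 = "Less (Const 1) (var ''rank'')" and ?b2 = "BAnd (Less (Const 2) (var ''rank'')) (Less (var ''old'') (Const 1))"
  define s1 where "s1 = s(''out'' := (s ''out'')(v * n + w := 1))"
  have K1: "output_edges n s1 = insert {v, w} ?K"
    unfolding s1_def using v(1) w(1) by (rule output_edges_add) simp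
  have f1: "frame {''mark'', ''out'', ''j''} s s1" by (simp add: s1_def frame_upd frame_refl)
  have g1: "holds_graph n E s1" using s f1 by (rule holds_graph_frame) simp
  have "runs use_best (bcost ?b1 + (10 + (bcost ?b2 + 6 + (100 * n + 8))) + (bcost (Less (Const 0) (var ''rank'')) + 6 + 1)) s ?Q"
    unfolding use_best_def
  proof (rule runs_Cond)
    assume "beval ?b1 s"
    then have r2: "2 \<le> r" by (simp add: var_def vwr)
    have "runs (Assign ''out'' ?a (Const 1)) 10 s (\<lambda>s'. s' = s1)"
      by (rule runs_loop_free) (use row in \<open>simp_all add: var_def s1_def vwr\<close>)
    then show "runs (Seq (Assign ''out'' ?a (Const 1))
       (Cond ?b2 (Assign ''mark'' (var ''w'') (Const 2)) mark_neighbours)) (10 + (bcost ?b2 + 6 + (100 * n + 8))) s ?Q"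
    proof (rule runs_Seq)
      fix s' assume "s' = s1"
      show "runs (Cond ?b2 (Assign ''mark'' (var ''w'') (Const 2)) mark_neighbours) (bcost ?b2 + 6 + (100 * n + 8)) s' ?Q"
        unfolding \<open>s' = s1\<close>
      proof (rule runs_Cond)
        assume "beval ?b2 s1"
        then have "2 < r" "reached E m v = {}" using old by (simp_all add: var_def s1_def vwr)
        then have "marking_inv (m(w := 2)) (insert {v, w} ?K)"
          using inv v(2) three by (intro marking_inv_pendant) auto
        moreover have "card (unmarked n (m(w := 2))) < card (unmarked n m)"
          using w by (intro unmarked_decreases[of w]) (auto split: if_splits)
        moreover have "output_edges n (s1(''mark'' := m(w := 2))) = output_edges n s1"
          by (simp add: output_edges_def)
        moreover have "result (Assign ''mark'' (var ''w'') (Const 2)) s1 = s1(''mark'' := m(w := 2))"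
          using m by (simp add: var_def s1_def vwr)
        ultimately show "runs (Assign ''mark'' (var ''w'') (Const 2)) 6 s1 ?Q"
          using f1 K1 by (intro runs_loop_free) (simp_all add: frame_upd var_def)
      next
        assume nb: "\<not> beval ?b2 s1"
        then have nb': "\<not> 2 < r \<or> reached E m v \<noteq> {}" using old by (auto simp: var_def s1_def vwr)
        have ne: "reached E m v \<noteq> {}"
        proof (cases "2 < r")
          case False
          then have "vertex_rank E m v = 2" using r2 v(3) by simp
          then show ?thesis by (auto simp: vertex_rank_def split: if_splits)
        qed (use nb' in simp)
        have "fresh E m v = {w} \<or> (\<forall>u. m u = 0 \<longrightarrow> card (fresh E m u) \<noteq> 1)"
          using three none by (cases "2 < r") auto
        then have inv': "marking_inv (\<lambda>x. if x \<in> fresh E m v then 1 else m x) (insert {v, w} ?K)"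
          using inv v(2,4) ne by (intro marking_inv_augment) auto
        have less: "card (unmarked n (\<lambda>x. if x \<in> fresh E m v then 1 else m x)) < card (unmarked n m)"
          using w v(4) by (intro unmarked_decreases[of w]) (auto split: if_splits)
        have "runs mark_neighbours (100 * n + 8) s1 (\<lambda>s2. frame {''mark'', ''j''} s1 s2 \<and>
            s2 ''mark'' = (\<lambda>x. if x \<in> fresh E m v then 1 else m x))"
          using v(1) m by (intro runs_mark_neighbours[OF graph g1]) (simp_all add: s1_def vwr)
        then show "runs mark_neighbours (100 * n + 8) s1 ?Q"
        proof (rule runs_weaken)
          fix s2 assume s2: "frame {''mark'', ''j''} s1 s2 \<and>
            s2 ''mark'' = (\<lambda>x. if x \<in> fresh E m v then 1 else m x)"
          then have f2: "frame {''mark'', ''j''} s1 s2" by simp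
          have "frame {''mark'', ''out'', ''j''} s s2" using f1 f2 by (rule frame_trans) auto
          moreover have "output_edges n s2 = insert {v, w} ?K"
            using output_edges_frame[OF f2] K1 by simp
          ultimately show "?Q s2" using s2 inv' less by simp
        qed simp
      qed
    qed
  next
    assume "\<not> beval ?b1 s"
    then have r1: "r = 1" using pos by (simp add: var_def vwr)
    have "vertex_rank E m v \<noteq> 1" if "reached E m v \<noteq> {}"
      using that by (simp add: vertex_rank_def)
    then have ne: "reached E m v = {}" using v(3) r1 by metis
    have inv': "marking_inv (m(v := 1)) ?K"
      using inv v(2,4) ne none closed r1 by (intro marking_inv_restart) auto
    have less: "card (unmarked n (m(v := 1))) < card (unmarked n m)"
      using v(1,2) by (intro unmarked_decreases[of v]) (auto split: if_splits)
    have res: "result (Cond (Less (Const 0) (var ''rank'')) (Assign ''mark'' (var ''v'') (Const 1)) Skip) s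
        = s(''mark'' := m(v := 1))"
      using m pos by (simp add: var_def vwr)
    have "output_edges n (s(''mark'' := m(v := 1))) = ?K" by (simp add: output_edges_def)
    then show "runs (Cond (Less (Const 0) (var ''rank'')) (Assign ''mark'' (var ''v'') (Const 1)) Skip)
        (bcost (Less (Const 0) (var ''rank'')) + 6 + 1) s ?Q"
      by (intro runs_loop_free) (use res inv' less in \<open>simp_all add: frame_upd frame_refl var_def\<close>)
  qed
  then show ?thesis by (rule runs_weaken) (simp_all add: var_def)
qed

lemma runs_use_best_idle:
  assumes "s ''rank'' 0 = 0"
  shows "runs use_best (100 * n + 100) s (\<lambda>s'. s' = s)"
proof -
  let ?b1 = "Less (Const 1) (var ''rank'')"
  let ?c = "Cond (Less (Const 0) (var ''rank'')) (Assign ''mark'' (var ''v'') (Const 1)) Skip"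
  have "runs use_best (bcost ?b1 + 0 + 20) s (\<lambda>s'. s' = s)"
    unfolding use_best_def
  proof (rule runs_Cond)
    assume "beval ?b1 s"
    then show "runs (Seq (Assign ''out'' (Add (Cell ''row'' (var ''v'')) (var ''w'')) (Const 1))
       (Cond (BAnd (Less (Const 2) (var ''rank'')) (Less (var ''old'') (Const 1)))
         (Assign ''mark'' (var ''w'') (Const 2)) mark_neighbours)) 0 s (\<lambda>s'. s' = s)"
      using assms by (simp add: var_def)
  next
    show "runs ?c 20 s (\<lambda>s'. s' = s)"
      by (rule runs_loop_free) (use assms in \<open>simp_all add: var_def\<close>)
  qed
  then show ?thesis by (rule runs_weaken) (simp_all add: var_def)
qed

lemma runs_round:
  assumes s: "holds_graph n E s" and inv: "marking_inv (s ''mark'') (output_edges n s)"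
    and i: "card (unmarked n (s ''mark'')) + i \<le> n \<or> finished E (s ''mark'')"
  shows "runs (Seq find_best use_best) (n * (100 * n + 200) + 20 + (100 * n + 100)) s (\<lambda>s'.
    s' ''i'' = s ''i'' \<and> holds_graph n E s' \<and> marking_inv (s' ''mark'') (output_edges n s') \<and>
    (card (unmarked n (s' ''mark'')) + (i + 1) \<le> n \<or> finished E (s' ''mark'')))"
  using runs_find_best[OF graph s refl]
proof (rule runs_Seq)
  let ?B = "{''rank'', ''u'', ''x'', ''y'', ''z'', ''j'', ''q'', ''v'', ''w'', ''old''}"
  let ?m = "s ''mark''"
  fix s1 assume s1: "frame ?B s s1 \<and> best_below E ?m n s1"
  then have f1: "frame ?B s s1" and best: "best_below E ?m n s1" by auto
  have g1: "holds_graph n E s1" using s f1 by (rule holds_graph_frame) simp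
  have m1: "s1 ''mark'' = ?m" and i1: "s1 ''i'' = s ''i''"
    using frameD[OF f1, of "''mark''"] frameD[OF f1, of "''i''"] by simp_all
  have out1: "output_edges n s1 = output_edges n s" using f1 by (rule output_edges_frame) simp
  show "runs use_best (100 * n + 100) s1 (\<lambda>s'.
    s' ''i'' = s ''i'' \<and> holds_graph n E s' \<and> marking_inv (s' ''mark'') (output_edges n s') \<and>
    (card (unmarked n (s' ''mark'')) + (i + 1) \<le> n \<or> finished E (s' ''mark'')))"
  proof (cases "s1 ''rank'' 0 = 0")
    case True
    have "fresh E ?m u = {}" if "?m u = 0" for u
    proof (cases "u < n")
      case u: True
      then have "vertex_rank E ?m u = 0" using best True by (simp add: best_below_def)
      then show ?thesis using that by (rule rank_zero)
    qed (rule fresh_outside)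
    then have "finished E ?m" by (simp add: finished_def)
    have "runs use_best (100 * n + 100) s1 (\<lambda>s'. s' = s1)"
      using True by (rule runs_use_best_idle)
    then show ?thesis
      by (rule runs_weaken) (use g1 m1 i1 out1 inv \<open>finished E ?m\<close> in simp_all)
  next
    case False
    then have "s1 ''w'' 0 \<in> fresh E ?m (s1 ''v'' 0)" "?m (s1 ''v'' 0) = 0"
      using best by (simp_all add: best_below_def)
    then have "\<not> finished E ?m" by (auto simp: finished_def)
    then have i': "card (unmarked n ?m) + i \<le> n" using i by blast
    have "marking_inv ?m (output_edges n s1)" using inv out1 by simp
    from runs_use_best[OF g1 m1 this best] False
    have "runs use_best (100 * n + 100) s1 (\<lambda>s'. frame {''mark'', ''out'', ''j''} s1 s' \<and>
      marking_inv (s' ''mark'') (output_edges n s') \<and> card (unmarked n (s' ''mark'')) < card (unmarked n ?m))"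
      by simp
    then show ?thesis
    proof (rule runs_weaken)
      fix s2 assume s2: "frame {''mark'', ''out'', ''j''} s1 s2 \<and>
        marking_inv (s2 ''mark'') (output_edges n s2) \<and> card (unmarked n (s2 ''mark'')) < card (unmarked n ?m)"
      then have f2: "frame {''mark'', ''out'', ''j''} s1 s2" by simp
      have "holds_graph n E s2" using g1 f2 by (rule holds_graph_frame) simp
      moreover have "s2 ''i'' = s ''i''" using frameD[OF f2, of "''i''"] i1 by simp
      ultimately show "s2 ''i'' = s ''i'' \<and> holds_graph n E s2 \<and> marking_inv (s2 ''mark'') (output_edges n s2) \<and>
        (card (unmarked n (s2 ''mark'')) + (i + 1) \<le> n \<or> finished E (s2 ''mark''))"
        using s2 i' by auto
    qed simp
  qed
qed

lemma runs_ur_program: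
  "runs ur_program (poly [:30, 170, 300, 100:] n) (input_memory n E) (\<lambda>s.
     marking_inv (s ''mark'') (output_edges n s) \<and> finished E (s ''mark''))"
proof -
  let ?T = "n * (100 * n + 200) + 20 + (100 * n + 100)"
  let ?I = "\<lambda>i s. holds_graph n E s \<and> marking_inv (s ''mark'') (output_edges n s) \<and>
    (card (unmarked n (s ''mark'')) + i \<le> n \<or> finished E (s ''mark''))"
  have upd: "?I i (s(''i'' := f)) \<longleftrightarrow> ?I i s" for i s f
    by (simp add: holds_graph_def output_edges_def)
  have "runs ur_program ((30 * n + 20) + (n * (?T + 11) + 8)) (input_memory n E) (\<lambda>s.
     marking_inv (s ''mark'') (output_edges n s) \<and> finished E (s ''mark''))"
    unfolding ur_program_def using runs_fill_rows
  proof (rule runs_Seq)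
    fix s :: memory
    assume s: "holds_graph n E s \<and> (\<forall>v. s ''mark'' v = 0) \<and> (\<forall>k. s ''out'' k = 0)"
    then have mk: "s ''mark'' = (\<lambda>_. 0)" and out: "output_edges n s = {}"
      by (auto simp: output_edges_def)
    have "card (unmarked n (s ''mark'')) \<le> card {..<n}"
      by (rule card_mono) (auto simp: unmarked_def)
    then have I0: "?I 0 s" using s mk out marking_inv_start by simp
    show "runs (for_below_n ''i'' (Seq find_best use_best)) (n * (?T + 11) + 8) s (\<lambda>s.
       marking_inv (s ''mark'') (output_edges n s) \<and> finished E (s ''mark''))"
    proof (rule runs_for_below_n[where I = ?I])
      show "?I 0 (s(''i'' := (s ''i'')(0 := 0)))" unfolding upd by (rule I0)
    next
      fix i s assume "?I i s"
      then show "s ''n'' 0 = n" by (simp add: holds_graph_def)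
    next
      fix i s assume "i < n" and I: "?I i s" and i: "s ''i'' 0 = i"
      have "runs (Seq find_best use_best) ?T s (\<lambda>s'. s' ''i'' = s ''i'' \<and> ?I (i + 1) s')"
        using I by (intro runs_round) blast+
      then show "runs (Seq find_best use_best) ?T s
          (\<lambda>s'. s' ''i'' 0 = i \<and> ?I (i + 1) (s'(''i'' := (s' ''i'')(0 := i + 1))))"
        by (rule runs_weaken) (use i in \<open>simp_all only: upd le_refl simp_thms\<close>)
    next
      fix s assume I: "?I n s"
      have "finished E (s ''mark'')" if "card (unmarked n (s ''mark'')) + n \<le> n"
      proof -
        have "unmarked n (s ''mark'') = {}" using that by (simp add: unmarked_def)
        then show ?thesis using nbrs_less(1)[OF graph] by (auto simp: finished_def fresh_def unmarked_def)
      qed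
      then show "marking_inv (s ''mark'') (output_edges n s) \<and> finished E (s ''mark'')" using I by blast
    qed
  qed
  then show ?thesis by (rule runs_weaken) (simp_all add: algebra_simps)
qed

end

theorem theorem1:
  fixes \<Delta> :: nat
  assumes "\<Delta> \<ge> 3"
  shows "\<exists>(prog :: com) (q :: nat poly). \<forall>(n :: nat) (E :: nat set set).
           graph {..<n} E \<and> connected_graph {..<n} E \<and> C4_free E \<and> bipartite {..<n} E \<and>
           max_degree {..<n} E \<le> \<Delta> \<longrightarrow>
           (\<exists>t s. exec prog (input_memory n E) t s \<and> t \<le> poly q n \<and>
              uniquely_restricted E (output_edges n s) \<and>
              real (card (output_edges n s)) \<ge>
                ((real \<Delta> - 1)\<^sup>2 + (real \<Delta> - 2)) / ((real \<Delta> - 1)^3 + (real \<Delta> - 2))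
                  * real (ur_matching_number E))"
proof (intro exI[of _ ur_program] exI[of _ "[:30, 170, 300, 100:]"] allI impI)
  fix n :: nat and E :: "nat set set"
  assume G: "graph {..<n} E \<and> connected_graph {..<n} E \<and> C4_free E \<and> bipartite {..<n} E \<and>
    max_degree {..<n} E \<le> \<Delta>"
  define d where "d = \<Delta> - 1"
  have d: "\<Delta> = d + 1" "2 \<le> d" using assms by (simp_all add: d_def)
  have input: "bounded_bipartite {..<n} E d"
    using G d degree_le_max_degree[of "{..<n}" E \<Delta>] by unfold_locales auto
  obtain t s where t: "exec ur_program (input_memory n E) t s" "t \<le> poly [:30, 170, 300, 100:] n"
    and inv: "bounded_bipartite.marking_inv {..<n} E d (s ''mark'') (output_edges n s)"
    and fin: "finished E (s ''mark'')"
    using runs_ur_program[OF input] by (auto simp: runs_def)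
  have all: "fresh E (s ''mark'') v = {}" if "s ''mark'' v = 0" for v
    using fin that by (simp add: finished_def)
  let ?K = "output_edges n s" and ?\<nu> = "ur_matching_number E"
  note final = bounded_bipartite.marking_inv_final[OF input inv all]
  have "real_of_int ((int d ^ 2 + int d - 1) * int ?\<nu>) \<le> real_of_int ((int d ^ 3 + int d - 1) * int (card ?K))"
    using final(2) by (simp only: of_int_le_iff)
  then have le: "(real d ^ 2 + real d - 1) * real ?\<nu> \<le> (real d ^ 3 + real d - 1) * real (card ?K)"
    by simp
  have "0 < real d ^ 3 + real d - 1" using d(2) zero_le_power[of "real d" 3] by linarith
  then have "(real d ^ 2 + real d - 1) / (real d ^ 3 + real d - 1) * real ?\<nu> \<le> real (card ?K)"
    using le by (simp add: field_simps)
  then have "((real \<Delta> - 1)\<^sup>2 + (real \<Delta> - 2)) / ((real \<Delta> - 1)^3 + (real \<Delta> - 2)) * real ?\<nu> \<le> real (card ?K)"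
    by (simp add: d(1) algebra_simps)
  then show "\<exists>t s. exec ur_program (input_memory n E) t s \<and> t \<le> poly [:30, 170, 300, 100:] n \<and>
      uniquely_restricted E (output_edges n s) \<and>
      real (card (output_edges n s)) \<ge>
        ((real \<Delta> - 1)\<^sup>2 + (real \<Delta> - 2)) / ((real \<Delta> - 1)^3 + (real \<Delta> - 2)) * real (ur_matching_number E)"
    using t final(1) by blast
qed

end
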